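(* Let $\Lambda \in \mathcal{P}(\mathfrak{C})$ and $\kappa \in (0,\infty)$. Then the problem $$\inf\Big\{ J_{\Lambda,\kappa}(\nu) := \int_{\mathfrak{C}} \mathrm{HK}_\kappa^2(\mu,\nu)\,d\Lambda(\mu) \;\Big|\; \nu \in \mathcal{M}_+(\Omega)\Big\}$$ admits a minimizer $\nu \in \mathfrak{C}$.
   Context: $\Omega \subset \mathbb{R}^d$ is a compact convex set with non-empty interior. $\mathcal{M}_+(\Omega)$ denotes the non-negative Radon measures on $\Omega$ with the weak* topology (duality with continuous functions), and $\|\mu\| = \mu(\Omega)$. For $\kappa\in(0,\infty)$ and $\mu,\nu\in\mathcal{M}_+(\Omega)$ the Hellinger--Kantorovich distance is $$\mathrm{HK}_\kappa^2(\mu,\nu) := \inf_{\gamma\in\mathcal{M}_+(\Omega\times\Omega)} \int \hat c_\kappa\,d\gamma + \mathrm{KL}(P_1\gamma|\mu)+\mathrm{KL}(P_2\gamma|\nu),$$ where $P_1\gamma,P_2\gamma$ are the two marginals of $\gamma$, $\hat c_\kappa(x,y) = -2\log\cos(|x-y|/\kappa)$ if $|x-y|\le\kappa\pi/2$ (with $-\log 0=+\infty$) and $+\infty$ otherwise, and $\mathrm{KL}(\mu|\nu)=\int\varphi(d\mu/d\nu)\,d\nu$ if $\mu\ll\nu$, $\mu\ge0$, and $+\infty$ otherwise, with $\varphi(s)=s\log s-s+1$ for $s>0$, $\varphi(0)=1$. It is known that $\mathrm{HK}_\kappa$ metrizes the weak* topology on $\mathcal{M}_+(\Omega)$. Fix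 $M\in(0,\infty)$ and let $\mathfrak{C} := \{\mu\in\mathcal{M}_+(\Omega) : \|\mu\|\le M\}$, a compact metrizable space in the weak* topology, equipped with its Borel $\sigma$-algebra; $\mathcal{P}(\mathfrak{C})$ is the set of Borel probability measures on $\mathfrak{C}$. *)

theory Defs
  imports "HOL-Probability.Probability"
begin

text \<open>On a compact subset of a Euclidean space every finite Borel measure is Radon, so
  non-negative Radon measures are finite measures on the Borel \<open>\<sigma>\<close>-algebra of the subset.\<close>

definition nonneg_measures :: "'a::topological_space set \<Rightarrow> 'a measure set" where
  "nonneg_measures \<Omega> = {\<mu>. sets \<mu> = sets (restrict_space borel \<Omega>) \<and> finite_measure \<mu>}"

definition weak_star_topology :: "'a::topological_space set \<Rightarrow> 'a measure topology" where
  "weak_star_topology \<Omega> = topology_generated_by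
     {{\<mu> \<in> nonneg_measures \<Omega>. (\<integral>x. f x \<partial>\<mu>) \<in> U} | (f :: 'a \<Rightarrow> real) U. continuous_on \<Omega> f \<and> open U}"

lemma topspace_weak_star_topology [simp]:
  "topspace (weak_star_topology \<Omega>) = nonneg_measures \<Omega>"
proof -
  have "nonneg_measures \<Omega> \<in> {{\<mu> \<in> nonneg_measures \<Omega>. (\<integral>x. f x \<partial>\<mu>) \<in> U} |
      (f :: 'a \<Rightarrow> real) U. continuous_on \<Omega> f \<and> open U}"
    by (rule CollectI, rule exI[of _ "\<lambda>_. 0"], rule exI[of _ UNIV]) auto
  then show ?thesis
    unfolding weak_star_topology_def topology_generated_by_topspace by blast
qed

definition bounded_measures :: "'a::topological_space set \<Rightarrow> real \<Rightarrow> 'a measure set" where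
  "bounded_measures \<Omega> M = {\<mu> \<in> nonneg_measures \<Omega>. measure \<mu> \<Omega> \<le> M}"

definition borel_algebra_of :: "'a topology \<Rightarrow> 'a measure" where
  "borel_algebra_of X = sigma (topspace X) {U. openin X U}"

definition borel_probabilities :: "'a topology \<Rightarrow> 'a measure set" where
  "borel_probabilities X = {\<Lambda>. sets \<Lambda> = sets (borel_algebra_of X) \<and> prob_space \<Lambda>}"

definition kl_entropy :: "real \<Rightarrow> real" where
  "kl_entropy s = (if s = 0 then 1 else s * ln s - s + 1)"

text \<open>Used only for finite measures on a common \<open>\<sigma>\<close>-algebra, where the density is finite
  almost everywhere and \<^const>\<open>enn2real\<close> loses nothing; \<^const>\<open>kl_entropy\<close> is
  non-negative on non-negative reals, so \<^const>\<open>ennreal\<close> truncates nothing.\<close>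

definition KL :: "'a measure \<Rightarrow> 'a measure \<Rightarrow> ennreal" where
  "KL \<mu> \<nu> = (if absolutely_continuous \<nu> \<mu>
     then \<integral>\<^sup>+x. ennreal (kl_entropy (enn2real (RN_deriv \<nu> \<mu> x))) \<partial>\<nu> else \<infinity>)"

text \<open>The strict inequality accounts for the convention \<open>- log 0 = \<infinity>\<close>: at distance exactly
  \<open>\<kappa> * pi / 2\<close> the cosine vanishes.\<close>

definition hk_cost :: "real \<Rightarrow> 'a::real_normed_vector \<Rightarrow> 'a \<Rightarrow> ennreal" where
  "hk_cost \<kappa> x y = (if norm (x - y) < \<kappa> * pi / 2
     then ennreal (- 2 * ln (cos (norm (x - y) / \<kappa>))) else \<infinity>)"

definition HK_squared ::
    "'a::euclidean_space set \<Rightarrow> real \<Rightarrow> 'a measure \<Rightarrow> 'a measure \<Rightarrow> ennreal" where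
  "HK_squared \<Omega> \<kappa> \<mu> \<nu> = (INF \<gamma> \<in> nonneg_measures (\<Omega> \<times> \<Omega>).
     (\<integral>\<^sup>+z. hk_cost \<kappa> (fst z) (snd z) \<partial>\<gamma>)
       + KL (distr \<gamma> (restrict_space borel \<Omega>) fst) \<mu>
       + KL (distr \<gamma> (restrict_space borel \<Omega>) snd) \<nu>)"

text \<open>The lower-integral reading that the library gives to \<open>\<integral>\<^sup>+\<close> for non-measurable integrands
  plays no role: \<^const>\<open>HK_squared\<close> is weak* continuous in \<open>\<mu>\<close>, hence measurable
  for the Borel \<open>\<sigma>\<close>-algebra.\<close>

definition HK_barycenter_functional ::
    "'a::euclidean_space set \<Rightarrow> 'a measure measure \<Rightarrow> real \<Rightarrow> 'a measure \<Rightarrow> ennreal" where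
  "HK_barycenter_functional \<Omega> \<Lambda> \<kappa> \<nu> = (\<integral>\<^sup>+\<mu>. HK_squared \<Omega> \<kappa> \<mu> \<nu> \<partial>\<Lambda>)"

end

theory Submission
  imports Defs
begin

text \<open>Direct method. The entropy is a supremum of weak* continuous functionals
  \<open>\<integral>\<phi> d\<alpha> - \<integral>(exp \<phi> - 1) d\<mu>\<close>, and so is the transport cost; superlinear growth of the entropy bounds the
  masses of almost optimal plans, which therefore subconverge. Hence \<open>HK\<^sup>2\<close> is jointly
  sequentially lower semicontinuous on measures of bounded mass, so it is Borel in the first
  argument and Fatou's lemma makes the functional lower semicontinuous. Weak* compactness comes
  from Helly's theorem on the line, carried over by a space-filling curve. A competitor \<open>\<nu>\<close> of
  mass above \<open>M\<close> may be rescaled to mass \<open>M\<close>, as this increases the distance to no measure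
  of mass at most \<open>M\<close>.\<close>

section \<open>A space-filling curve\<close>

text \<open>Densities do not survive weak* limits, so the entropy is handled through its dual
  functional for one fixed continuous \<phi>. That functional is linear in the pair of measures,
  which lets both arguments vary at once. The price is the converse direction: the optimal \<phi> is
  the logarithm of a density, in general neither continuous nor bounded, and has to be reached by
  truncation and by approximation in the mean for \<alpha> and \<mu> together.

  Compactness has to produce a limit measure, not just a limit functional. For a continuous
  \<open>h\<close> from the line onto a compact convex set with measurable right inverse
  \<open>s\<close>, integrals of \<open>f\<close> become integrals of the continuous
  \<open>f (h t)\<close> over laws on the line. The discontinuity of \<open>s\<close> does no harm,
  as \<open>h (s x) = x\<close>, and the limit is the image of a limit law under \<open>h\<close>.

  Limits are taken along sequences, whereas the Borel sets come from a topology. The bridge is that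
  countably many test functions govern convergence of measures of bounded mass.\<close>

text \<open>For \<open>t\<close> with ternary digits 0 and 2 only, the wave at \<open>3 ^ m * t\<close> reads off half the digit
  \<open>m\<close> of \<open>t\<close> (Schoenberg); any continuous wave of period 2 that is 0 on \<open>[0, 1/3]\<close> and 1 on
  \<open>[2/3, 1]\<close> would do.\<close>

definition schoenberg_wave :: "real \<Rightarrow> real" where
  "schoenberg_wave t = max 0 (min 1 (1 / 2 - cos (pi * t)))"

lemma schoenberg_wave_bounds: "0 \<le> schoenberg_wave t" "schoenberg_wave t \<le> 1"
  by (auto simp: schoenberg_wave_def)

lemma continuous_on_schoenberg_wave [continuous_intros]:
  fixes f :: "'a::t2_space \<Rightarrow> real"
  shows "continuous_on A f \<Longrightarrow> continuous_on A (\<lambda>t. schoenberg_wave (f t))"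
  unfolding schoenberg_wave_def by (intro continuous_intros)

lemma schoenberg_wave_add_even: "schoenberg_wave (s + 2 * real N) = schoenberg_wave s"
proof -
  have "cos (pi * (s + 2 * real N)) = cos (pi * s + real (2 * N) * pi)"
    by (simp add: algebra_simps)
  also have "\<dots> = cos (pi * s)"
    unfolding cos_add cos_npi sin_npi by simp
  finally have "cos (pi * (s + 2 * real N)) = cos (pi * s)" .
  then show ?thesis
    by (simp add: schoenberg_wave_def)
qed

lemma schoenberg_wave_eq_0:
  assumes "0 \<le> t" "t \<le> 1 / 3"
  shows "schoenberg_wave t = 0"
proof -
  have "cos (pi / 3) \<le> cos (pi * t)"
    using assms by (subst cos_mono_le_eq) (auto simp: field_simps)
  then show ?thesis
    by (simp add: schoenberg_wave_def cos_60)
qed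

lemma schoenberg_wave_eq_1:
  assumes "2 / 3 \<le> t" "t \<le> 1"
  shows "schoenberg_wave t = 1"
proof -
  have "cos (pi - pi * t) \<ge> cos (pi / 3)"
    using assms by (subst cos_mono_le_eq) (auto simp: field_simps)
  then show ?thesis
    by (simp add: schoenberg_wave_def cos_60 cos_diff)
qed

text \<open>The point of the Cantor set with ternary digits \<open>2 * c m\<close>,
  \<open>2 * c (m + 1)\<close>, and so on, when \<open>c\<close> takes the values 0 and 1. Raising
  \<open>m\<close> drops the leading digit.\<close>

definition ternary_tail :: "(nat \<Rightarrow> nat) \<Rightarrow> nat \<Rightarrow> real" where
  "ternary_tail c m = (\<Sum>j. 2 * real (c (m + j)) / 3 ^ Suc j)"

lemma ternary_tail:
  assumes c: "\<And>j. c j \<le> 1"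
  shows ternary_tail_nonneg: "0 \<le> ternary_tail c m"
    and ternary_tail_le_1: "ternary_tail c m \<le> 1"
    and ternary_tail_Suc: "3 * ternary_tail c m = 2 * real (c m) + ternary_tail c (Suc m)"
proof -
  have geo: "(\<lambda>j. 2 / 3 ^ Suc j :: real) sums 1"
    using sums_mult[OF geometric_sums[of "1 / 3 :: real"], of "2 / 3"]
    by (simp add: power_divide)
  have le: "2 * real (c (m + j)) / 3 ^ Suc j \<le> 2 / 3 ^ Suc j" for m j
    using c[of "m + j"] by (intro divide_right_mono) auto
  have summable: "summable (\<lambda>j. 2 * real (c (m + j)) / 3 ^ Suc j)" for m
    by (rule summable_comparison_test'[OF sums_summable[OF geo], of 0]) (use le in auto)
  show "0 \<le> ternary_tail c m"
    unfolding ternary_tail_def by (intro suminf_nonneg summable) auto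
  show "ternary_tail c m \<le> 1"
    unfolding ternary_tail_def sums_unique[OF geo]
    by (intro suminf_le summable sums_summable[OF geo] le)
  have "ternary_tail c m = (\<Sum>j. 2 * real (c (m + Suc j)) / 3 ^ Suc (Suc j)) + 2 * real (c m) / 3"
    unfolding ternary_tail_def using suminf_split_head[OF summable[of m]] by simp
  also have "(\<Sum>j. 2 * real (c (m + Suc j)) / 3 ^ Suc (Suc j)) = ternary_tail c (Suc m) / 3"
    unfolding ternary_tail_def suminf_divide[OF summable[of "Suc m"], symmetric]
    by (simp add: field_simps)
  finally show "3 * ternary_tail c m = 2 * real (c m) + ternary_tail c (Suc m)"
    by simp
qed

text \<open>Multiplication by \<open>3 ^ m\<close> moves \<open>m\<close> digits in front of the
  point. These digits are even, so they form an even integer, invisible to a wave of period 2. The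
  remaining tail lies in the lower or the upper third of the unit interval according to its first
  digit.\<close>

lemma schoenberg_wave_ternary_tail:
  assumes c: "\<And>j. c j \<le> 1"
  shows "schoenberg_wave (3 ^ m * ternary_tail c 0) = real (c m)"
proof -
  have "\<exists>N. 3 ^ m * ternary_tail c 0 = ternary_tail c m + 2 * real N"
  proof (induction m)
    case 0
    show ?case by (rule exI[of _ 0]) simp
  next
    case (Suc m)
    then obtain N where "3 ^ m * ternary_tail c 0 = ternary_tail c m + 2 * real N" by blast
    then have "3 ^ Suc m * ternary_tail c 0 = 3 * ternary_tail c m + 6 * real N"
      by simp
    also have "\<dots> = ternary_tail c (Suc m) + 2 * real (c m + 3 * N)"
      unfolding ternary_tail_Suc[of c, OF c] by simp
    finally show ?case by blast
  qed
  then obtain N where "3 ^ m * ternary_tail c 0 = ternary_tail c m + 2 * real N" by blast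
  then have "schoenberg_wave (3 ^ m * ternary_tail c 0) = schoenberg_wave (ternary_tail c m)"
    by (simp add: schoenberg_wave_add_even)
  moreover have "c m = 0 \<or> c m = 1"
    using c[of m] by auto
  ultimately show ?thesis
    using ternary_tail_Suc[of c m, OF c] ternary_tail_nonneg[of c "Suc m", OF c]
      ternary_tail_le_1[of c "Suc m", OF c]
    by (auto intro!: schoenberg_wave_eq_0 schoenberg_wave_eq_1)
qed

text \<open>The partial sums telescope to the floor of \<open>2 ^ n * y\<close> over
  \<open>2 ^ n\<close>, up to the floor of \<open>y\<close>, which vanishes because
  \<open>y < 1\<close>. This is why the cube covered below is half-open.\<close>

lemma binary_expansion:
  assumes "0 \<le> y" "y < (1 :: real)"
  obtains \<beta> :: "nat \<Rightarrow> nat" where "\<And>k. \<beta> k \<le> 1" "(\<lambda>k. real (\<beta> k) / 2 ^ Suc k) sums y"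
proof
  define \<beta> where "\<beta> k = nat (\<lfloor>2 ^ Suc k * y\<rfloor> - 2 * \<lfloor>2 ^ k * y\<rfloor>)" for k
  have digit: "0 \<le> \<lfloor>2 ^ Suc k * y\<rfloor> - 2 * \<lfloor>2 ^ k * y\<rfloor>"
    "\<lfloor>2 ^ Suc k * y\<rfloor> - 2 * \<lfloor>2 ^ k * y\<rfloor> \<le> 1" for k
  proof -
    have "2 * real_of_int \<lfloor>2 ^ k * y\<rfloor> \<le> 2 ^ Suc k * y" "2 ^ Suc k * y < 2 * real_of_int \<lfloor>2 ^ k * y\<rfloor> + 2"
      using floor_correct[of "2 ^ k * y"] unfolding power_Suc mult.assoc by linarith+
    then show "0 \<le> \<lfloor>2 ^ Suc k * y\<rfloor> - 2 * \<lfloor>2 ^ k * y\<rfloor>"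
      "\<lfloor>2 ^ Suc k * y\<rfloor> - 2 * \<lfloor>2 ^ k * y\<rfloor> \<le> 1"
      by linarith+
  qed
  show "\<beta> k \<le> 1" for k
    using digit[of k] by (simp add: \<beta>_def)
  have partial: "(\<Sum>k<n. real (\<beta> k) / 2 ^ Suc k) = real_of_int \<lfloor>2 ^ n * y\<rfloor> / 2 ^ n" for n
  proof (induction n)
    case 0
    have "\<lfloor>y\<rfloor> = 0" using assms by linarith
    then show ?case by simp
  next
    case (Suc n)
    have "real (\<beta> n) = real_of_int \<lfloor>2 ^ Suc n * y\<rfloor> - 2 * real_of_int \<lfloor>2 ^ n * y\<rfloor>"
      using digit(1)[of n] by (simp add: \<beta>_def)
    then show ?case
      using Suc by (simp add: field_simps)
  qed
  have "(\<lambda>n. real_of_int \<lfloor>2 ^ n * y\<rfloor> / 2 ^ n) \<longlonglongrightarrow> y"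
  proof (rule tendsto_sandwich)
    show "\<forall>\<^sub>F n in sequentially. y - (1 / 2) ^ n \<le> real_of_int \<lfloor>2 ^ n * y\<rfloor> / 2 ^ n"
    proof (intro always_eventually allI)
      fix n :: nat
      have "(2 ^ n * y - 1) / 2 ^ n \<le> real_of_int \<lfloor>2 ^ n * y\<rfloor> / 2 ^ n"
        by (intro divide_right_mono) (linarith, simp)
      then show "y - (1 / 2) ^ n \<le> real_of_int \<lfloor>2 ^ n * y\<rfloor> / 2 ^ n"
        by (simp add: diff_divide_distrib power_divide)
    qed
    show "\<forall>\<^sub>F n in sequentially. real_of_int \<lfloor>2 ^ n * y\<rfloor> / 2 ^ n \<le> y"
      by (intro always_eventually allI) (simp add: field_simps)
    show "(\<lambda>n. y - (1 / 2) ^ n) \<longlonglongrightarrow> y"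
      using tendsto_diff[OF tendsto_const LIMSEQ_realpow_zero[of "1 / 2 :: real"], of y] by simp
  qed simp
  then show "(\<lambda>k. real (\<beta> k) / 2 ^ Suc k) sums y"
    unfolding sums_def partial .
qed

text \<open>A single digit sequence encodes all coordinates, and each coordinate is read off by its
  own family of waves. The weights \<open>1 / 2 ^ Suc k\<close> make the series uniformly
  convergent, hence continuous.\<close>

theorem space_filling_curve:
  obtains g :: "real \<Rightarrow> 'b::euclidean_space"
  where "continuous_on UNIV g" "{y. \<forall>b\<in>Basis. 0 \<le> y \<bullet> b \<and> y \<bullet> b < 1} \<subseteq> g ` {0..1}"
proof -
  let ?d = "DIM('b)"
  obtain e :: "nat \<Rightarrow> 'b" where e: "bij_betw e {0..<?d} Basis"
    using ex_bij_betw_nat_finite[OF finite_Basis] by blast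
  define i where "i = the_inv_into {0..<?d} e"
  have i: "i b < ?d" "e (i b) = b" if "b \<in> Basis" for b
    using that e the_inv_into_into[of e "{0..<?d}" b "{0..<?d}"]
      f_the_inv_into_f[of e "{0..<?d}" b]
    by (auto simp: i_def bij_betw_def)
  define w where "w b k t = schoenberg_wave (3 ^ (?d * k + i b) * t) / 2 ^ Suc k" for b k and t :: real
  define g where "g t = (\<Sum>b\<in>Basis. (\<Sum>k. w b k t) *\<^sub>R b)" for t
  have geo: "summable (\<lambda>k. 1 / 2 ^ Suc k :: real)"
    using power_half_series sums_summable by (auto simp: power_divide)
  have "continuous_on UNIV (\<lambda>t. \<Sum>k. w b k t)" for b
  proof (rule uniform_limit_theorem)
    show "uniform_limit UNIV (\<lambda>n t. \<Sum>k<n. w b k t) (\<lambda>t. \<Sum>k. w b k t) sequentially"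
      by (rule Weierstrass_m_test[OF _ geo])
        (auto simp: w_def schoenberg_wave_bounds divide_simps)
  qed (auto simp: w_def intro!: always_eventually continuous_intros)
  then have "continuous_on UNIV g"
    unfolding g_def by (intro continuous_intros) auto
  moreover have "y \<in> g ` {0..1}" if y: "\<forall>b\<in>Basis. 0 \<le> y \<bullet> b \<and> y \<bullet> b < 1" for y
  proof -
    have "\<exists>\<beta>. (\<forall>k. \<beta> k \<le> 1) \<and> (\<lambda>k. real (\<beta> k) / 2 ^ Suc k) sums (y \<bullet> b)" if "b \<in> Basis" for b
      using y that binary_expansion[of "y \<bullet> b"] by metis
    then obtain \<beta> :: "'b \<Rightarrow> nat \<Rightarrow> nat" where \<beta>: "\<And>b k. b \<in> Basis \<Longrightarrow> \<beta> b k \<le> 1"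
      "\<And>b. b \<in> Basis \<Longrightarrow> (\<lambda>k. real (\<beta> b k) / 2 ^ Suc k) sums (y \<bullet> b)"
      by metis
    \<comment> \<open>Interleaving: place \<open>?d * k + i b\<close> holds binary digit
      \<open>k\<close> of coordinate \<open>b\<close>, matching the frequencies in
      \<open>w\<close>.\<close>
    define c where "c j = \<beta> (e (j mod ?d)) (j div ?d)" for j
    have "e (j mod ?d) \<in> Basis" for j
      using e by (auto simp: bij_betw_def)
    then have c: "c j \<le> 1" for j
      unfolding c_def by (rule \<beta>(1))
    have "w b k (ternary_tail c 0) = real (\<beta> b k) / 2 ^ Suc k" if "b \<in> Basis" for b k
      using i[OF that] by (simp add: w_def schoenberg_wave_ternary_tail[of c, OF c] c_def)
    then have "g (ternary_tail c 0) = (\<Sum>b\<in>Basis. (y \<bullet> b) *\<^sub>R b)"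
      unfolding g_def using \<beta>(2) by (auto intro!: sum.cong simp: sums_iff)
    then have "g (ternary_tail c 0) = y"
      by (simp add: euclidean_representation)
    then show ?thesis
      using ternary_tail_nonneg[of c 0, OF c] ternary_tail_le_1[of c 0, OF c] by force
  qed
  ultimately show ?thesis
    using that by blast
qed

section \<open>Sequential weak* compactness\<close>

lemma
  assumes "\<mu> \<in> nonneg_measures \<Omega>"
  shows nonneg_measures_sets: "sets \<mu> = sets (restrict_space borel \<Omega>)"
    and nonneg_measures_space: "space \<mu> = \<Omega>"
    and nonneg_measures_finite: "finite_measure \<mu>"
proof -
  show sets: "sets \<mu> = sets (restrict_space borel \<Omega>)" and "finite_measure \<mu>"
    using assms by (auto simp: nonneg_measures_def)
  show "space \<mu> = \<Omega>"
    using sets_eq_imp_space_eq[OF sets] by (simp add: space_restrict_space)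
qed

lemma continuous_on_borel_measurable:
  fixes f :: "'a::topological_space \<Rightarrow> 'b::topological_space"
  assumes "\<mu> \<in> nonneg_measures \<Omega>" "continuous_on \<Omega> f"
  shows "f \<in> borel_measurable \<mu>"
  using borel_measurable_continuous_on_restrict[OF assms(2)]
    measurable_cong_sets[OF nonneg_measures_sets[OF assms(1)] refl] by blast

lemma continuous_on_compact_bounded:
  fixes f :: "'a::topological_space \<Rightarrow> real"
  assumes "compact \<Omega>" "continuous_on \<Omega> f"
  obtains B where "0 < B" "\<And>x. x \<in> \<Omega> \<Longrightarrow> \<bar>f x\<bar> \<le> B"
  using compact_imp_bounded[OF compact_continuous_image[OF assms(2,1)]]
  by (auto simp: bounded_pos)

lemma continuous_on_integrable:
  fixes f :: "'a::topological_space \<Rightarrow> real"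
  assumes "\<mu> \<in> nonneg_measures \<Omega>" "compact \<Omega>" "continuous_on \<Omega> f"
  shows "integrable \<mu> f"
proof -
  interpret finite_measure \<mu> by (rule nonneg_measures_finite[OF assms(1)])
  obtain B where "\<And>x. x \<in> \<Omega> \<Longrightarrow> \<bar>f x\<bar> \<le> B"
    using continuous_on_compact_bounded[OF assms(2,3)] by blast
  then show ?thesis
    using continuous_on_borel_measurable[OF assms(1,3)] nonneg_measures_space[OF assms(1)]
    by (intro integrable_const_bound[where B = B]) auto
qed

lemma
  assumes \<mu>: "\<mu> \<in> nonneg_measures \<Omega>" and r: "0 \<le> r"
  shows scaled_in_nonneg_measures: "density \<mu> (\<lambda>_. ennreal r) \<in> nonneg_measures \<Omega>"
    and measure_scaled: "measure (density \<mu> (\<lambda>_. ennreal r)) \<Omega> = r * measure \<mu> \<Omega>"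
    and integral_scaled: "continuous_on \<Omega> f \<Longrightarrow>
      (\<integral>x. f x \<partial>density \<mu> (\<lambda>_. ennreal r)) = r * (\<integral>x. f x \<partial>\<mu> :: real)"
proof -
  interpret finite_measure \<mu> by (rule nonneg_measures_finite[OF \<mu>])
  have sp: "space \<mu> = \<Omega>" by (rule nonneg_measures_space[OF \<mu>])
  then have "\<Omega> \<in> sets \<mu>" by auto
  then have em: "emeasure (density \<mu> (\<lambda>_. ennreal r)) \<Omega> = ennreal r * emeasure \<mu> \<Omega>"
    by (rule emeasure_density_const)
  then show "measure (density \<mu> (\<lambda>_. ennreal r)) \<Omega> = r * measure \<mu> \<Omega>"
    using r by (simp add: measure_def enn2real_mult)
  have "finite_measure (density \<mu> (\<lambda>_. ennreal r))"
    by (rule finite_measureI) (simp add: sp em ennreal_mult_eq_top_iff)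
  then show "density \<mu> (\<lambda>_. ennreal r) \<in> nonneg_measures \<Omega>"
    using nonneg_measures_sets[OF \<mu>] by (simp add: nonneg_measures_def)
  show "(\<integral>x. f x \<partial>density \<mu> (\<lambda>_. ennreal r)) = r * (\<integral>x. f x \<partial>\<mu>)" if "continuous_on \<Omega> f"
    using r continuous_on_borel_measurable[OF \<mu> that] by (subst integral_density) auto
qed

lemma integral_one:
  "\<mu> \<in> nonneg_measures \<Omega> \<Longrightarrow> (\<integral>x. 1 \<partial>\<mu>) = measure \<mu> \<Omega>"
  by (simp add: nonneg_measures_space)

text \<open>Convergence is tested on integrals along a sequence; the topology itself enters only
  with the Borel sets. Membership of the limit in \<open>nonneg_measures\<close> is stated
  separately.\<close>

definition weak_star_converges ::
    "'a::topological_space set \<Rightarrow> (nat \<Rightarrow> 'a measure) \<Rightarrow> 'a measure \<Rightarrow> bool" where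
  "weak_star_converges \<Omega> X \<mu> \<longleftrightarrow>
     (\<forall>f :: 'a \<Rightarrow> real. continuous_on \<Omega> f \<longrightarrow> (\<lambda>n. \<integral>x. f x \<partial>X n) \<longlonglongrightarrow> (\<integral>x. f x \<partial>\<mu>))"

lemma weak_star_convergesD:
  fixes f :: "'a::topological_space \<Rightarrow> real"
  shows "weak_star_converges \<Omega> X \<mu> \<Longrightarrow> continuous_on \<Omega> f \<Longrightarrow>
    (\<lambda>n. \<integral>x. f x \<partial>X n) \<longlonglongrightarrow> (\<integral>x. f x \<partial>\<mu>)"
  by (simp add: weak_star_converges_def)

lemma weak_star_converges_subseq:
  assumes "weak_star_converges \<Omega> X \<mu>" "strict_mono r"
  shows "weak_star_converges \<Omega> (X \<circ> r) \<mu>"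
  unfolding weak_star_converges_def
  using LIMSEQ_subseq_LIMSEQ[OF weak_star_convergesD[OF assms(1)] assms(2)]
  by (auto simp: o_def)

text \<open>The total mass is the integral of the continuous function 1, so it passes to the
  limit.\<close>

lemma weak_star_converges_bounded:
  assumes conv: "weak_star_converges \<Omega> X \<mu>" and \<mu>: "\<mu> \<in> nonneg_measures \<Omega>"
    and X: "\<And>n. X n \<in> bounded_measures \<Omega> M"
  shows "\<mu> \<in> bounded_measures \<Omega> M"
proof -
  have mem: "X n \<in> nonneg_measures \<Omega>" and le: "measure (X n) \<Omega> \<le> M" for n
    using X[of n] by (auto simp: bounded_measures_def)
  have "(\<lambda>n. measure (X n) \<Omega>) \<longlonglongrightarrow> measure \<mu> \<Omega>"
    using weak_star_convergesD[OF conv, of "\<lambda>_. 1"]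
    unfolding integral_one[OF mem] integral_one[OF \<mu>] by simp
  then have "measure \<mu> \<Omega> \<le> M"
    by (rule LIMSEQ_le_const2) (use le in auto)
  then show ?thesis
    using \<mu> by (simp add: bounded_measures_def)
qed

text \<open>The curve is rescaled to a cube around \<open>K\<close> and followed by the
  nearest-point map, which is continuous by convexity and fixes \<open>K\<close>. The strict bound
  \<open>norm x < R\<close> keeps \<open>K\<close> inside the half-open cube that the curve is known
  to cover.\<close>

lemma compact_convex_parametrization:
  fixes K :: "'b::euclidean_space set"
  assumes K: "compact K" "convex K" "K \<noteq> {}"
  obtains h :: "real \<Rightarrow> 'b" where "continuous_on UNIV h" "range h \<subseteq> K" "h ` {0..1} = K"
proof -
  obtain g :: "real \<Rightarrow> 'b" where g: "continuous_on UNIV g"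
    "{y. \<forall>b\<in>Basis. 0 \<le> y \<bullet> b \<and> y \<bullet> b < 1} \<subseteq> g ` {0..1}"
    using space_filling_curve by blast
  obtain R where R: "0 < R" "\<And>x. x \<in> K \<Longrightarrow> norm x < R"
    using compact_imp_bounded[OF K(1)] unfolding bounded_pos_less by blast
  define h where "h t = closest_point K (R *\<^sub>R (2 *\<^sub>R g t - One))" for t
  have closed: "closed K" using K(1) by (rule compact_imp_closed)
  have "continuous_on UNIV h"
    unfolding h_def
    by (rule continuous_on_compose2[OF continuous_on_closest_point[OF K(2) closed K(3)]])
      (auto intro!: continuous_intros g(1))
  moreover have range: "h t \<in> K" for t
    unfolding h_def using closest_point_in_set[OF closed K(3)] .
  moreover have "x \<in> h ` {0..1}" if x: "x \<in> K" for x
  proof -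
    define y where "y = (1 / 2) *\<^sub>R ((1 / R) *\<^sub>R x + One)"
    have "0 \<le> y \<bullet> b \<and> y \<bullet> b < 1" if b: "b \<in> Basis" for b
    proof -
      have "\<bar>x \<bullet> b\<bar> < R" using Basis_le_norm[OF b, of x] R(2)[OF x] by linarith
      then have "-1 < (x \<bullet> b) / R" "(x \<bullet> b) / R < 1"
        using R(1) by (auto simp: field_simps)
      then show ?thesis
        using b by (simp add: y_def inner_add_left)
    qed
    then obtain t where t: "t \<in> {0..1}" "y = g t" using g(2) by blast
    have "R *\<^sub>R (2 *\<^sub>R g t - One) = x"
      using R(1) by (simp add: y_def flip: t(2))
    then have "h t = x"
      using x closest_point_self by (simp add: h_def)
    with t(1) show ?thesis by blast
  qed
  ultimately show ?thesis
    using that by blast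
qed

text \<open>Probability measures on \<open>K\<close> are lifted to \<open>[0, 1]\<close> along the section picking the first
  parameter of each point, so that Helly's theorem on the line applies.\<close>

lemma prob_measures_sequentially_compact:
  fixes K :: "'b::euclidean_space set" and P :: "nat \<Rightarrow> 'b measure"
  assumes K: "compact K" "convex K" "K \<noteq> {}"
    and P: "\<And>n. P n \<in> nonneg_measures K" "\<And>n. prob_space (P n)"
  obtains r \<mu> where "strict_mono (r :: nat \<Rightarrow> nat)" "\<mu> \<in> nonneg_measures K"
    "weak_star_converges K (P \<circ> r) \<mu>"
proof -
  obtain h :: "real \<Rightarrow> 'b" where h: "continuous_on UNIV h" "range h \<subseteq> K" "h ` {0..1} = K"
    using compact_convex_parametrization[OF K] .
  have cont: "continuous_on A h" for A
    by (rule continuous_on_subset[OF h(1)]) simp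
  define s where "s x = Inf {t \<in> {0..1}. h t = x}" for x
  have s: "s x \<in> {0..1}" "h (s x) = x" if "x \<in> K" for x
  proof -
    have "compact ({0..1} \<inter> h -` {x})"
      by (rule compact_Int_closed)
        (auto intro!: continuous_closed_vimage continuous_on_interior[OF h(1)])
    then have "closed {t \<in> {0..1}. h t = x}"
      by (simp add: vimage_def Int_def compact_imp_closed)
    moreover have "{t \<in> {0..1}. h t = x} \<noteq> {}"
      using h(3) that by blast
    ultimately have "s x \<in> {t \<in> {0..1}. h t = x}"
      unfolding s_def by (intro closed_contains_Inf) (auto intro: bdd_belowI[of _ 0])
    then show "s x \<in> {0..1}" "h (s x) = x" by auto
  qed
  \<comment> \<open>By minimality, the first parameter is at most \<open>a\<close> iff the point is
    already met on \<open>{0..min a 1}\<close>. The images of these intervals are compact, so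
    \<open>s\<close> is Borel although it may be discontinuous.\<close>
  have s_le: "{x \<in> K. s x \<le> a} = h ` {0..min a 1}" for a
  proof (intro equalityI subsetI)
    fix x assume "x \<in> {x \<in> K. s x \<le> a}"
    then show "x \<in> h ` {0..min a 1}"
      using s[of x] by (intro image_eqI[of _ _ "s x"]) auto
  next
    fix x assume "x \<in> h ` {0..min a 1}"
    then obtain t where t: "t \<in> {0..min a 1}" "x = h t" by blast
    then have "s x \<le> t"
      unfolding s_def by (intro cInf_lower) (auto intro: bdd_belowI[of _ 0])
    with t h(2) show "x \<in> {x \<in> K. s x \<le> a}" by auto
  qed
  have "s \<in> borel_measurable (restrict_space borel K)"
  proof (subst borel_measurable_iff_le, intro allI)
    fix a
    have "closed (h ` {0..min a 1})"
      using compact_continuous_image[OF cont compact_Icc] by (rule compact_imp_closed)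
    moreover have "h ` {0..min a 1} \<subseteq> K" using h(2) by blast
    ultimately show "{x \<in> space (restrict_space borel K). s x \<le> a} \<in> sets (restrict_space borel K)"
      using K(1) by (simp add: space_restrict_space s_le sets_restrict_space_iff compact_imp_closed)
  qed
  then have s_meas: "s \<in> borel_measurable (P n)" for n
    using measurable_cong_sets[OF nonneg_measures_sets[OF P(1)] refl] by blast
  define \<rho> where "\<rho> n = distr (P n) borel s" for n
  have dist: "real_distribution (\<rho> n)" for n
    unfolding \<rho>_def
    using prob_space.prob_space_distr[OF P(2) s_meas, of n]
    by (auto simp: real_distribution_def real_distribution_axioms_def)
  \<comment> \<open>Tightness is phrased with intervals open on the left; a left end below 0 keeps
    the parameter value 0.\<close>
  have "measure (\<rho> n) {-1<..1} = 1" for n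
  proof -
    interpret prob_space "P n" by (rule P(2))
    have "s -` {-1<..1} \<inter> space (P n) = space (P n)"
      using s(1) by (force simp: nonneg_measures_space[OF P(1)])
    then show ?thesis
      using s_meas by (simp add: \<rho>_def measure_distr prob_space)
  qed
  then have "\<forall>\<epsilon>>0. (-1 :: real) < 1 \<and> (\<forall>n. 1 - \<epsilon> < measure (\<rho> n) {-1<..1})"
    by simp
  then have "tight \<rho>"
    unfolding tight_def using dist by blast
  from tight_imp_convergent_subsubsequence[OF this strict_mono_id]
  obtain r Q where r: "strict_mono (r :: nat \<Rightarrow> nat)" and Q: "real_distribution Q"
    and conv: "weak_conv_m (\<rho> \<circ> r) Q"
    by auto
  interpret Q: real_distribution Q by (rule Q)
  have h_meas: "h \<in> measurable Q (restrict_space borel K)"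
    using h(2) borel_measurable_continuous_onI[OF h(1)]
    by (intro measurable_restrict_space2) auto
  \<comment> \<open>Since \<open>h\<close> maps the whole line into \<open>K\<close>, this is a
    measure on \<open>K\<close> wherever \<open>Q\<close> puts its mass.\<close>
  define \<mu> where "\<mu> = distr Q (restrict_space borel K) h"
  have "finite_measure \<mu>"
    unfolding \<mu>_def by (rule Q.finite_measure_distr[OF h_meas])
  then have "\<mu> \<in> nonneg_measures K"
    by (simp add: nonneg_measures_def \<mu>_def)
  moreover have "weak_star_converges K (P \<circ> r) \<mu>"
    unfolding weak_star_converges_def
  proof (intro allI impI)
    fix f :: "'b \<Rightarrow> real" assume f: "continuous_on K f"
    obtain B where B: "\<And>x. x \<in> K \<Longrightarrow> \<bar>f x\<bar> \<le> B"
      using continuous_on_compact_bounded[OF K(1) f] by blast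
    have fh: "continuous_on UNIV (\<lambda>t. f (h t))"
      by (rule continuous_on_compose2[OF f h(1,2)])
    have "(\<lambda>n. integral\<^sup>L ((\<rho> \<circ> r) n) (\<lambda>t. f (h t))) \<longlonglongrightarrow> integral\<^sup>L Q (\<lambda>t. f (h t))"
      using dist Q conv fh B h(2)
      by (intro weak_conv_imp_integral_bdd_continuous_conv[where B = B])
        (auto simp: o_def continuous_on_eq_continuous_at range_subsetD)
    moreover have "integral\<^sup>L (\<rho> n) (\<lambda>t. f (h t)) = (\<integral>x. f x \<partial>P n)" for n
    proof -
      have "integral\<^sup>L (\<rho> n) (\<lambda>t. f (h t)) = (\<integral>x. f (h (s x)) \<partial>P n)"
        unfolding \<rho>_def using s_meas borel_measurable_continuous_onI[OF fh]
        by (intro integral_distr) auto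
      also have "\<dots> = (\<integral>x. f x \<partial>P n)"
        using s(2) by (intro Bochner_Integration.integral_cong)
          (auto simp: nonneg_measures_space[OF P(1)])
      finally show ?thesis .
    qed
    moreover have "integral\<^sup>L Q (\<lambda>t. f (h t)) = (\<integral>x. f x \<partial>\<mu>)"
      unfolding \<mu>_def using borel_measurable_continuous_on_restrict[OF f]
      by (intro integral_distr[symmetric] h_meas) auto
    ultimately show "(\<lambda>n. \<integral>x. f x \<partial>(P \<circ> r) n) \<longlonglongrightarrow> (\<integral>x. f x \<partial>\<mu>)"
      by (simp add: o_def)
  qed
  ultimately show ?thesis
    using that r by blast
qed

text \<open>Each measure is split into mass times probability, and the factors converge along nested
  subsequences. The product form also covers a limit mass 0.\<close>

theorem bounded_measures_sequentially_compact:
  fixes K :: "'b::euclidean_space set" and X :: "nat \<Rightarrow> 'b measure"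
  assumes K: "compact K" "convex K" "K \<noteq> {}"
    and X: "\<And>n. X n \<in> bounded_measures K B"
  obtains r \<mu> where "strict_mono (r :: nat \<Rightarrow> nat)" "\<mu> \<in> bounded_measures K B"
    "weak_star_converges K (X \<circ> r) \<mu>"
proof -
  have mem: "X n \<in> nonneg_measures K" for n
    using X[of n] by (auto simp: bounded_measures_def)
  define m where "m n = measure (X n) K" for n
  have m: "0 \<le> m n" "m n \<le> B" for n
    using X[of n] by (auto simp: bounded_measures_def m_def)
  obtain x0 where x0: "x0 \<in> K" using K(3) by blast
  \<comment> \<open>A null measure cannot be normalised; a point mass stands in, and its weight
    \<open>m n\<close> is 0.\<close>
  define P where "P n = (if m n = 0 then return (restrict_space borel K) x0
    else density (X n) (\<lambda>_. ennreal (1 / m n)))" for n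
  have "P n \<in> nonneg_measures K \<and> prob_space (P n)" for n
  proof (cases "m n = 0")
    case True
    have "prob_space (return (restrict_space borel K) x0)"
      using x0 by (intro prob_space_return) (simp add: space_restrict_space)
    then show ?thesis
      using True by (auto simp: P_def nonneg_measures_def prob_space_def)
  next
    case False
    have P: "P n \<in> nonneg_measures K" "measure (P n) K = 1"
      using False m(1)[of n] scaled_in_nonneg_measures[OF mem, of "1 / m n" n]
        measure_scaled[OF mem, of "1 / m n" n]
      by (auto simp: P_def m_def)
    interpret finite_measure "P n" by (rule nonneg_measures_finite[OF P(1)])
    show ?thesis
      using P by (auto intro!: prob_spaceI simp: emeasure_eq_measure nonneg_measures_space)
  qed
  then have P: "P n \<in> nonneg_measures K" "prob_space (P n)" for n by auto
  have X_eq: "(\<integral>x. f x \<partial>X n) = m n * (\<integral>x. f x \<partial>P n)"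
    if f: "continuous_on K f" for f :: "'b \<Rightarrow> real" and n
  proof (cases "m n = 0")
    case True
    interpret finite_measure "X n" by (rule nonneg_measures_finite[OF mem])
    have "emeasure (X n) (space (X n)) = 0"
      using True by (simp add: m_def emeasure_eq_measure nonneg_measures_space[OF mem])
    then have "AE x in X n. f x = 0"
      by (intro AE_I[where N = "space (X n)"]) auto
    then show ?thesis
      using True continuous_on_borel_measurable[OF mem f] by (simp add: integral_cong_AE[where g = "\<lambda>_. 0"])
  next
    case False
    then show ?thesis
      using m(1)[of n] by (simp add: P_def integral_scaled[OF mem _ f])
  qed
  obtain r1 l where r1: "strict_mono (r1 :: nat \<Rightarrow> nat)" "(m \<circ> r1) \<longlonglongrightarrow> l"
    using bounded_imp_convergent_subsequence[of m] m
    by (metis (no_types, lifting) abs_of_nonneg bounded_iff imageE real_norm_def)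
  have l: "0 \<le> l"
    using LIMSEQ_le_const[OF r1(2), of 0] m(1) by auto
  obtain r2 \<mu> where r2: "strict_mono (r2 :: nat \<Rightarrow> nat)" and \<mu>: "\<mu> \<in> nonneg_measures K"
    and conv: "weak_star_converges K ((P \<circ> r1) \<circ> r2) \<mu>"
    using prob_measures_sequentially_compact[OF K, of "P \<circ> r1"] P by auto
  have "weak_star_converges K (X \<circ> (r1 \<circ> r2)) (density \<mu> (\<lambda>_. ennreal l))"
    unfolding weak_star_converges_def
  proof (intro allI impI)
    fix f :: "'b \<Rightarrow> real" assume f: "continuous_on K f"
    show "(\<lambda>n. \<integral>x. f x \<partial>(X \<circ> (r1 \<circ> r2)) n) \<longlonglongrightarrow> (\<integral>x. f x \<partial>density \<mu> (\<lambda>_. ennreal l))"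
      using tendsto_mult[OF LIMSEQ_subseq_LIMSEQ[OF r1(2) r2] weak_star_convergesD[OF conv f]]
      by (simp add: integral_scaled[OF \<mu> l f] X_eq[OF f] o_def)
  qed
  moreover have "strict_mono (r1 \<circ> r2)"
    using r1(1) r2 by (rule strict_mono_o)
  ultimately show ?thesis
    using that weak_star_converges_bounded[OF _ scaled_in_nonneg_measures[OF \<mu> l], of "X \<circ> (r1 \<circ> r2)" B] X
    by auto
qed

section \<open>Density of continuous functions in \<open>L\<^sup>1\<close>\<close>

text \<open>Integrability is recorded because the Bochner integral of a non-integrable function is
  0, which would satisfy the smallness condition for free.\<close>

definition L1_approximable :: "'a::topological_space set \<Rightarrow> 'a measure \<Rightarrow> ('a \<Rightarrow> real) \<Rightarrow> bool" where
  "L1_approximable \<Omega> N f \<longleftrightarrow> integrable N f \<and>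
     (\<forall>e>0. \<exists>g. continuous_on \<Omega> g \<and> (\<integral>x. \<bar>f x - g x\<bar> \<partial>N) < e)"

context
  fixes \<Omega> :: "'a::metric_space set" and N :: "'a measure"
  assumes compact: "compact \<Omega>" and N: "N \<in> nonneg_measures \<Omega>"
begin

interpretation finite_measure N by (rule nonneg_measures_finite[OF N])

lemma L1_approximable_continuous:
  "continuous_on \<Omega> f \<Longrightarrow> L1_approximable \<Omega> N f"
  unfolding L1_approximable_def using continuous_on_integrable[OF N compact] by force

lemma L1_approximable_closure:
  assumes "integrable N f" "\<And>e. 0 < e \<Longrightarrow> \<exists>h. L1_approximable \<Omega> N h \<and> (\<integral>x. \<bar>f x - h x\<bar> \<partial>N) < e"
  shows "L1_approximable \<Omega> N f"
  unfolding L1_approximable_def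
proof (intro conjI allI impI assms(1))
  fix e :: real assume "0 < e"
  then obtain h where h: "L1_approximable \<Omega> N h" "(\<integral>x. \<bar>f x - h x\<bar> \<partial>N) < e / 2"
    using assms(2)[of "e / 2"] by auto
  with \<open>0 < e\<close> obtain g where g: "continuous_on \<Omega> g" "(\<integral>x. \<bar>h x - g x\<bar> \<partial>N) < e / 2"
    unfolding L1_approximable_def by (meson half_gt_zero)
  have int: "integrable N h" "integrable N g"
    using h(1) continuous_on_integrable[OF N compact g(1)] by (auto simp: L1_approximable_def)
  have "(\<integral>x. \<bar>f x - g x\<bar> \<partial>N) \<le> (\<integral>x. \<bar>f x - h x\<bar> + \<bar>h x - g x\<bar> \<partial>N)"
    using assms(1) int by (intro integral_mono) auto
  also have "\<dots> = (\<integral>x. \<bar>f x - h x\<bar> \<partial>N) + (\<integral>x. \<bar>h x - g x\<bar> \<partial>N)"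
    using assms(1) int by (intro Bochner_Integration.integral_add) auto
  also have "\<dots> < e"
    using h(2) g(2) by simp
  finally show "\<exists>g. continuous_on \<Omega> g \<and> (\<integral>x. \<bar>f x - g x\<bar> \<partial>N) < e"
    using g(1) by blast
qed

lemma L1_approximable_add:
  assumes "L1_approximable \<Omega> N f" "L1_approximable \<Omega> N g"
  shows "L1_approximable \<Omega> N (\<lambda>x. f x + g x)"
  unfolding L1_approximable_def
proof (intro conjI allI impI)
  have int: "integrable N f" "integrable N g"
    using assms by (auto simp: L1_approximable_def)
  then show "integrable N (\<lambda>x. f x + g x)" by simp
  fix e :: real assume "0 < e"
  then obtain f' g' where f': "continuous_on \<Omega> f'" "(\<integral>x. \<bar>f x - f' x\<bar> \<partial>N) < e / 2"
    and g': "continuous_on \<Omega> g'" "(\<integral>x. \<bar>g x - g' x\<bar> \<partial>N) < e / 2"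
    using assms unfolding L1_approximable_def by (meson half_gt_zero)
  have int': "integrable N f'" "integrable N g'"
    using f'(1) g'(1) by (auto intro: continuous_on_integrable[OF N compact])
  have "(\<integral>x. \<bar>f x + g x - (f' x + g' x)\<bar> \<partial>N) \<le> (\<integral>x. \<bar>f x - f' x\<bar> + \<bar>g x - g' x\<bar> \<partial>N)"
    using int int' by (intro integral_mono) auto
  also have "\<dots> = (\<integral>x. \<bar>f x - f' x\<bar> \<partial>N) + (\<integral>x. \<bar>g x - g' x\<bar> \<partial>N)"
    using int int' by (intro Bochner_Integration.integral_add) auto
  also have "\<dots> < e"
    using f'(2) g'(2) by simp
  finally show "\<exists>h. continuous_on \<Omega> h \<and> (\<integral>x. \<bar>f x + g x - h x\<bar> \<partial>N) < e"
    using continuous_on_add[OF f'(1) g'(1)] by blast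
qed

lemma L1_approximable_cmult:
  assumes "L1_approximable \<Omega> N f"
  shows "L1_approximable \<Omega> N (\<lambda>x. c * f x)"
  unfolding L1_approximable_def
proof (intro conjI allI impI)
  show "integrable N (\<lambda>x. c * f x)"
    using assms by (auto simp: L1_approximable_def)
  fix e :: real assume e: "0 < e"
  \<comment> \<open>The added 1 covers \<open>c = 0\<close>.\<close>
  then have "0 < e / (\<bar>c\<bar> + 1)" by (intro divide_pos_pos) auto
  then obtain g where g: "continuous_on \<Omega> g" "(\<integral>x. \<bar>f x - g x\<bar> \<partial>N) < e / (\<bar>c\<bar> + 1)"
    using assms unfolding L1_approximable_def by blast
  have "(\<integral>x. \<bar>c * f x - c * g x\<bar> \<partial>N) = \<bar>c\<bar> * (\<integral>x. \<bar>f x - g x\<bar> \<partial>N)"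
    unfolding right_diff_distrib[symmetric] abs_mult by simp
  also have "\<dots> \<le> (\<bar>c\<bar> + 1) * (\<integral>x. \<bar>f x - g x\<bar> \<partial>N)"
    by (intro mult_right_mono) auto
  also have "\<dots> < e"
    using g(2) by (simp add: pos_less_divide_eq mult.commute add_pos_nonneg)
  finally show "\<exists>h. continuous_on \<Omega> h \<and> (\<integral>x. \<bar>c * f x - h x\<bar> \<partial>N) < e"
    using continuous_on_mult_left[OF g(1), of c] by blast
qed

lemma L1_approximable_dominated:
  assumes s: "\<And>i :: nat. L1_approximable \<Omega> N (s i)" and f: "integrable N f" and w: "integrable N w"
    and conv: "\<And>x. x \<in> \<Omega> \<Longrightarrow> (\<lambda>i. s i x) \<longlonglongrightarrow> f x"
    and bound: "\<And>i x. x \<in> \<Omega> \<Longrightarrow> \<bar>s i x\<bar> \<le> w x"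
  shows "L1_approximable \<Omega> N f"
proof (rule L1_approximable_closure[OF f])
  fix e :: real assume "0 < e"
  have s_int: "integrable N (s i)" for i
    using s by (auto simp: L1_approximable_def)
  have "(\<lambda>i. \<integral>x. \<bar>f x - s i x\<bar> \<partial>N) \<longlonglongrightarrow> (\<integral>x. 0 \<partial>N)"
  proof (rule integral_dominated_convergence[where w = "\<lambda>x. \<bar>f x\<bar> + w x"])
    show "AE x in N. (\<lambda>i. \<bar>f x - s i x\<bar>) \<longlonglongrightarrow> 0"
    proof (rule AE_I2)
      fix x assume "x \<in> space N"
      then have "(\<lambda>i. \<bar>f x - s i x\<bar>) \<longlonglongrightarrow> \<bar>f x - f x\<bar>"
        using conv by (intro tendsto_intros) (auto simp: nonneg_measures_space[OF N])
      then show "(\<lambda>i. \<bar>f x - s i x\<bar>) \<longlonglongrightarrow> 0" by simp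
    qed
    show "AE x in N. norm \<bar>f x - s i x\<bar> \<le> \<bar>f x\<bar> + w x" for i
    proof (rule AE_I2)
      fix x assume "x \<in> space N"
      then show "norm \<bar>f x - s i x\<bar> \<le> \<bar>f x\<bar> + w x"
        using bound[of x i] by (auto simp: nonneg_measures_space[OF N])
    qed
  qed (use f w s_int in auto)
  then have "\<forall>\<^sub>F i in sequentially. (\<integral>x. \<bar>f x - s i x\<bar> \<partial>N) < e"
    using \<open>0 < e\<close> by (intro order_tendstoD) auto
  then show "\<exists>h. L1_approximable \<Omega> N h \<and> (\<integral>x. \<bar>f x - h x\<bar> \<partial>N) < e"
    using s by (auto simp: eventually_sequentially)
qed

lemma indicator_integrable:
  assumes "A \<in> sets borel"
  shows "integrable N (indicator A :: 'a \<Rightarrow> real)"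
proof (rule integrable_const_bound[where B = 1])
  have "(indicator A :: 'a \<Rightarrow> real) \<in> borel_measurable (restrict_space borel \<Omega>)"
    using assms by (intro measurable_restrict_space1) simp
  then show "(indicator A :: 'a \<Rightarrow> real) \<in> borel_measurable N"
    using measurable_cong_sets[OF nonneg_measures_sets[OF N] refl] by blast
qed (auto simp: indicator_def)

lemma indicator_empty_eq: "indicator {} = (\<lambda>_. 0)"
  by (simp add: fun_eq_iff)

text \<open>Truncated multiples of the distance decrease to the indicator, because the distance is
  positive off a closed set. The empty set is excluded since \<open>infdist\<close> to it is 0 by
  convention.\<close>

lemma L1_approximable_closed:
  assumes F: "closed F" "F \<noteq> {}"
  shows "L1_approximable \<Omega> N (indicator F)"
proof (rule L1_approximable_dominated)
  show "L1_approximable \<Omega> N (\<lambda>x. max 0 (1 - real i * infdist x F))" for i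
    by (intro L1_approximable_continuous continuous_intros)
  show "integrable N (indicator F :: 'a \<Rightarrow> real)"
    using F(1) by (intro indicator_integrable) auto
  show "integrable N (\<lambda>_. 1 :: real)" by simp
  show "\<bar>max 0 (1 - real i * infdist x F)\<bar> \<le> 1" for i x
    using infdist_nonneg[of x F] by auto
  show "(\<lambda>i. max 0 (1 - real i * infdist x F)) \<longlonglongrightarrow> indicator F x" for x
  proof (cases "x \<in> F")
    case True
    then show ?thesis by simp
  next
    case False
    then have pos: "0 < infdist x F"
      using F infdist_pos_not_in_closed by blast
    obtain n where n: "1 < real n * infdist x F"
      using reals_Archimedean3[OF pos] by blast
    have "max 0 (1 - real i * infdist x F) = 0" if "n \<le> i" for i
    proof -
      have "real n * infdist x F \<le> real i * infdist x F"
        using pos that by (intro mult_right_mono) auto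
      with n show ?thesis by simp
    qed
    then show ?thesis
      using False by (intro tendsto_eventually eventually_sequentiallyI[of n]) simp
  qed
qed

text \<open>Dynkin's argument: the closed sets are an intersection-stable generator, and the
  property passes to complements and, as partial sums of disjoint indicators stay below 1, to
  countable disjoint unions.\<close>

lemma L1_approximable_indicator:
  assumes "A \<in> sets borel"
  shows "L1_approximable \<Omega> N (indicator A)"
proof -
  have gen: "sets borel = sigma_sets UNIV {F :: 'a set. closed F}"
    unfolding borel_eq_closed by (simp add: sets_measure_of_conv)
  have "Int_stable {F :: 'a set. closed F}"
    by (auto simp: Int_stable_def)
  moreover have "{F :: 'a set. closed F} \<subseteq> Pow UNIV" by auto
  moreover have "A \<in> sigma_sets UNIV {F. closed F}"
    using assms gen by simp
  ultimately show ?thesis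
  proof (induction rule: sigma_sets_induct_disjoint)
    case (basic F)
    then show ?case
      using L1_approximable_closed[of F] L1_approximable_continuous[of "\<lambda>_. 0"]
      by (cases "F = {}") (simp_all add: indicator_empty_eq)
  next
    case empty
    then show ?case
      using L1_approximable_continuous[of "\<lambda>_. 0"] by (simp add: indicator_empty_eq)
  next
    case (compl A)
    have "L1_approximable \<Omega> N (\<lambda>x. 1 + - 1 * indicator A x)"
      using compl by (intro L1_approximable_add L1_approximable_cmult)
        (auto intro: L1_approximable_continuous)
    moreover have "(\<lambda>x. 1 + - 1 * indicator A x :: real) = indicator (UNIV - A)"
      by (auto simp: indicator_def)
    ultimately show ?case by simp
  next
    case (union A)
    have A: "A i \<in> sets borel" for i
      using union(2) gen by auto
    have partial: "L1_approximable \<Omega> N (\<lambda>x. \<Sum>i<n. indicator (A i) x)" for n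
      by (induction n)
        (auto intro: L1_approximable_continuous L1_approximable_add union)
    have eq: "(\<Sum>i<n. indicator (A i) x) = (indicator (\<Union>i<n. A i) x :: real)" for n x
      using union(1)
      by (subst indicator_UN_disjoint) (auto simp: disjoint_family_on_def)
    show ?case
    proof (rule L1_approximable_dominated[OF partial, where w = "\<lambda>_. 1"])
      show "integrable N (indicator (\<Union>i. A i) :: 'a \<Rightarrow> real)"
        using A by (intro indicator_integrable) auto
      show "(\<lambda>n. \<Sum>i<n. indicator (A i) x) \<longlonglongrightarrow> (indicator (\<Union>i. A i) x :: real)" for x
        unfolding eq by (rule LIMSEQ_indicator_UN)
      show "\<bar>\<Sum>i<n. indicator (A i) x :: real\<bar> \<le> 1" for n x
        unfolding eq by (simp add: indicator_def)
    qed simp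
  qed
qed

lemma L1_approximable_integrable:
  assumes "integrable N f"
  shows "L1_approximable \<Omega> N f"
  using assms
proof (induction rule: integrable_induct)
  case (base A c)
  have "\<Omega> \<in> sets borel"
    by (intro borel_closed compact_imp_closed compact)
  then have "A \<in> sets borel"
    using base(1) by (simp add: nonneg_measures_sets[OF N] sets_restrict_space_iff)
  then show ?case
    using L1_approximable_cmult[OF L1_approximable_indicator, of A c]
    by (simp add: mult.commute)
next
  case (add f g)
  then show ?case by (intro L1_approximable_add)
next
  case (lim f s)
  \<comment> \<open>The bound \<open>2 * \<bar>f x\<bar>\<close> on the approximating functions is
    supplied by the induction rule.\<close>
  show ?case
    by (rule L1_approximable_dominated[of s f "\<lambda>x. 2 * \<bar>f x\<bar>"])
      (use lim in \<open>auto simp: nonneg_measures_space[OF N]\<close>)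
qed

end

lemma nn_integral_mono_measure:
  assumes "sets N = sets M" "\<And>A. A \<in> sets M \<Longrightarrow> emeasure M A \<le> emeasure N A"
  shows "nn_integral M f \<le> nn_integral N f"
  unfolding nn_integral_def
proof (rule SUP_mono)
  have space: "space N = space M"
    using assms(1) by (rule sets_eq_imp_space_eq)
  fix g assume "g \<in> {g. simple_function M g \<and> g \<le> f}"
  then have g: "simple_function M g" "g \<le> f" by auto
  have "simple_function N g"
    using g(1) simple_function_cong_algebra[OF assms(1) space] by blast
  moreover have "integral\<^sup>S M g \<le> integral\<^sup>S N g"
    unfolding simple_integral_def space
    using g(1) assms(2) by (intro sum_mono mult_left_mono) (auto dest: simple_functionD)
  ultimately show "\<exists>g'\<in>{g. simple_function N g \<and> g \<le> f}. integral\<^sup>S M g \<le> integral\<^sup>S N g'"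
    using g(2) by blast
qed

text \<open>Here \<open>N\<close> is \<alpha> + \<mu>: an approximation in the mean for
  \<open>N\<close> serves both integrals of the dual functional at once.\<close>

lemma sum_of_measures:
  assumes "\<alpha> \<in> nonneg_measures \<Omega>" "\<mu> \<in> nonneg_measures \<Omega>"
  obtains N where "N \<in> nonneg_measures \<Omega>" "\<And>f. nn_integral \<alpha> f \<le> nn_integral N f" "\<And>f. nn_integral \<mu> f \<le> nn_integral N f"
proof -
  have sets: "sets \<mu> = sets \<alpha>"
    using assms by (simp add: nonneg_measures_sets)
  define N where "N = measure_of (space \<alpha>) (sets \<alpha>) (\<lambda>A. emeasure \<alpha> A + emeasure \<mu> A)"
  have sets_N: "sets N = sets \<alpha>"
    by (simp add: N_def)
  have N: "emeasure N A = emeasure \<alpha> A + emeasure \<mu> A" if "A \<in> sets \<alpha>" for A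
  proof (rule emeasure_measure_of[OF N_def])
    show "countably_additive (sets N) (\<lambda>A. emeasure \<alpha> A + emeasure \<mu> A)"
      unfolding countably_additive_def sets_N
    proof (intro allI impI)
      fix A :: "nat \<Rightarrow> 'a set" assume A: "range A \<subseteq> sets \<alpha>" "disjoint_family A"
      have "(\<Sum>i. emeasure \<alpha> (A i) + emeasure \<mu> (A i)) = (\<Sum>i. emeasure \<alpha> (A i)) + (\<Sum>i. emeasure \<mu> (A i))"
        by (intro suminf_add[symmetric]) auto
      then show "(\<Sum>i. emeasure \<alpha> (A i) + emeasure \<mu> (A i)) = emeasure \<alpha> (\<Union>(range A)) + emeasure \<mu> (\<Union>(range A))"
        using A sets by (simp add: suminf_emeasure)
    qed
  qed (use that sets_N sets.space_closed in \<open>auto simp: positive_def\<close>)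
  have space: "space N = \<Omega>"
    using sets_eq_imp_space_eq[OF sets_N] nonneg_measures_space[OF assms(1)] by simp
  interpret \<alpha>: finite_measure \<alpha> by (rule nonneg_measures_finite[OF assms(1)])
  interpret \<mu>: finite_measure \<mu> by (rule nonneg_measures_finite[OF assms(2)])
  have "\<Omega> \<in> sets \<alpha>"
    using nonneg_measures_space[OF assms(1)] by auto
  then have "finite_measure N"
    by (intro finite_measureI) (simp add: space N \<alpha>.emeasure_eq_measure \<mu>.emeasure_eq_measure)
  then have "N \<in> nonneg_measures \<Omega>"
    using sets_N nonneg_measures_sets[OF assms(1)] by (simp add: nonneg_measures_def)
  moreover have "nn_integral \<alpha> f \<le> nn_integral N f" "nn_integral \<mu> f \<le> nn_integral N f" for f
    using N sets sets_N by (intro nn_integral_mono_measure; simp)+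
  ultimately show ?thesis
    using that by blast
qed

section \<open>The dual formula for the entropy\<close>

lemma bounded_measurable_integrable:
  fixes f :: "'a::topological_space \<Rightarrow> real"
  assumes "\<mu> \<in> nonneg_measures \<Omega>" "f \<in> borel_measurable \<mu>" "\<And>x. x \<in> \<Omega> \<Longrightarrow> \<bar>f x\<bar> \<le> C"
  shows "integrable \<mu> f"
proof -
  interpret finite_measure \<mu> by (rule nonneg_measures_finite[OF assms(1)])
  show ?thesis
    using assms(2,3) nonneg_measures_space[OF assms(1)]
    by (intro integrable_const_bound[where B = C]) auto
qed

text \<open>The tangent of \<open>exp\<close> at \<open>a\<close> lies below the graph, and its
  slope \<open>exp a\<close> is at most \<open>exp C\<close>; for \<open>a < b\<close> the left side
  is negative.\<close>

lemma exp_diff_le: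
  fixes a b :: real
  assumes "a \<le> C"
  shows "exp a - exp b \<le> exp C * \<bar>a - b\<bar>"
proof (cases "b \<le> a")
  case True
  have "exp a * (1 + (b - a)) \<le> exp a * exp (b - a)"
    by (intro mult_left_mono exp_ge_add_one_self) auto
  then have "exp a - exp b \<le> exp a * \<bar>a - b\<bar>"
    using True by (simp add: exp_diff algebra_simps)
  also have "\<dots> \<le> exp C * \<bar>a - b\<bar>"
    using assms by (intro mult_right_mono) auto
  finally show ?thesis .
next
  case False
  then have "exp a - exp b \<le> 0" by simp
  also have "0 \<le> exp C * \<bar>a - b\<bar>" by simp
  finally show ?thesis .
qed

lemma abs_exp_minus_1_le:
  fixes a :: real
  assumes "\<bar>a\<bar> \<le> C"
  shows "\<bar>exp a - 1\<bar> \<le> exp C + 1"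
proof -
  have "0 < exp a" "exp a \<le> exp C" using assms by auto
  then show ?thesis by linarith
qed

text \<open>The test functions that matter, multiples of indicators and truncated logarithms of
  densities, are merely measurable. They are approximated in the mean for \<alpha> + \<mu>.\<close>

lemma kl_dual_bounded_measurable:
  fixes \<Omega> :: "'a::metric_space set" and B :: real
  assumes compact: "compact \<Omega>" and \<alpha>: "\<alpha> \<in> nonneg_measures \<Omega>" and \<mu>: "\<mu> \<in> nonneg_measures \<Omega>"
    and dual: "\<And>\<phi>. continuous_on \<Omega> \<phi> \<Longrightarrow> (\<integral>x. \<phi> x \<partial>\<alpha>) - (\<integral>x. exp (\<phi> x) - 1 \<partial>\<mu>) \<le> B"
    and \<phi>: "\<phi> \<in> borel_measurable \<mu>" "\<And>x. x \<in> \<Omega> \<Longrightarrow> \<bar>\<phi> x\<bar> \<le> C"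
  shows "(\<integral>x. \<phi> x \<partial>\<alpha>) - (\<integral>x. exp (\<phi> x) - 1 \<partial>\<mu>) \<le> B"
proof (rule field_le_epsilon)
  fix e :: real assume e: "0 < e"
  obtain N where N: "N \<in> nonneg_measures \<Omega>" "\<And>f. nn_integral \<alpha> f \<le> nn_integral N f"
    "\<And>f. nn_integral \<mu> f \<le> nn_integral N f"
    using sum_of_measures[OF \<alpha> \<mu>] by blast
  have \<phi>_int: "integrable \<nu> \<phi>" if "\<nu> \<in> nonneg_measures \<Omega>" for \<nu>
    using measurable_cong_sets[of \<mu> \<nu> borel borel] \<phi> that
    by (intro bounded_measurable_integrable[OF that, of _ C])
      (auto simp: nonneg_measures_sets[OF \<mu>] nonneg_measures_sets[OF that])
  \<comment> \<open>An error \<delta> in the mean costs at most \<delta> in the linear term and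
    \<open>exp C * \<delta>\<close> in the exponential one.\<close>
  define \<delta> where "\<delta> = e / (1 + exp C)"
  have "0 < 1 + exp C" by (simp add: add_pos_pos)
  then have \<delta>: "0 < \<delta>" "\<delta> * (1 + exp C) = e"
    using e by (simp_all add: \<delta>_def)
  obtain g where g: "continuous_on \<Omega> g" "(\<integral>x. \<bar>\<phi> x - g x\<bar> \<partial>N) < \<delta>"
    using L1_approximable_integrable[OF compact N(1) \<phi>_int[OF N(1)]] \<delta>(1)
    unfolding L1_approximable_def by blast
  have int: "integrable \<nu> (\<lambda>x. \<bar>\<phi> x - g x\<bar>)" if "\<nu> \<in> nonneg_measures \<Omega>" for \<nu>
    using \<phi>_int[OF that] continuous_on_integrable[OF that compact g(1)] by simp
  have small: "(\<integral>x. \<bar>\<phi> x - g x\<bar> \<partial>\<nu>) < \<delta>"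
    if \<nu>: "\<nu> \<in> nonneg_measures \<Omega>" and le: "\<And>f. nn_integral \<nu> f \<le> nn_integral N f" for \<nu>
  proof -
    have "ennreal (\<integral>x. \<bar>\<phi> x - g x\<bar> \<partial>\<nu>) \<le> ennreal (\<integral>x. \<bar>\<phi> x - g x\<bar> \<partial>N)"
      using le[of "\<lambda>x. ennreal \<bar>\<phi> x - g x\<bar>"] int[OF \<nu>] int[OF N(1)]
      by (simp add: nn_integral_eq_integral)
    then show ?thesis
      using g(2) by (simp add: ennreal_le_iff)
  qed
  \<comment> \<open>Clamping to the range of \<phi> brings the approximation no further away and
    bounds the slope of \<open>exp\<close> by \<open>exp C\<close>.\<close>
  define h where "h x = max (- C) (min C (g x))" for x
  have h: "continuous_on \<Omega> h"
    unfolding h_def by (intro continuous_intros g(1))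
  have closer: "\<bar>h x - \<phi> x\<bar> \<le> \<bar>\<phi> x - g x\<bar>" if "x \<in> \<Omega>" for x
    using \<phi>(2)[OF that] by (auto simp: h_def max_def min_def)
  have exp_\<phi>: "integrable \<mu> (\<lambda>x. exp (\<phi> x) - 1)"
    using \<phi>(1) by (intro bounded_measurable_integrable[OF \<mu> _ abs_exp_minus_1_le[OF \<phi>(2)]]) auto
  have exp_h: "integrable \<mu> (\<lambda>x. exp (h x) - 1)"
    by (intro continuous_on_integrable[OF \<mu> compact] continuous_intros h)
  have "(\<integral>x. \<phi> x \<partial>\<alpha>) - (\<integral>x. h x \<partial>\<alpha>) = (\<integral>x. \<phi> x - h x \<partial>\<alpha>)"
    using \<phi>_int[OF \<alpha>] continuous_on_integrable[OF \<alpha> compact h] by simp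
  also have "\<dots> \<le> (\<integral>x. \<bar>\<phi> x - g x\<bar> \<partial>\<alpha>)"
  proof (rule integral_mono)
    show "\<phi> x - h x \<le> \<bar>\<phi> x - g x\<bar>" if "x \<in> space \<alpha>" for x
      using closer[of x] that by (simp add: nonneg_measures_space[OF \<alpha>])
  qed (use \<phi>_int[OF \<alpha>] continuous_on_integrable[OF \<alpha> compact h] int[OF \<alpha>] in auto)
  also have "\<dots> < \<delta>" by (rule small[OF \<alpha> N(2)])
  finally have 1: "(\<integral>x. \<phi> x \<partial>\<alpha>) - (\<integral>x. h x \<partial>\<alpha>) < \<delta>" .
  have "(\<integral>x. exp (h x) - 1 \<partial>\<mu>) - (\<integral>x. exp (\<phi> x) - 1 \<partial>\<mu>) =
      (\<integral>x. (exp (h x) - 1) - (exp (\<phi> x) - 1) \<partial>\<mu>)"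
    by (rule Bochner_Integration.integral_diff[OF exp_h exp_\<phi>, symmetric])
  also have "\<dots> \<le> (\<integral>x. exp C * \<bar>\<phi> x - g x\<bar> \<partial>\<mu>)"
  proof (rule integral_mono)
    show "integrable \<mu> (\<lambda>x. exp (h x) - 1 - (exp (\<phi> x) - 1))"
      by (rule Bochner_Integration.integrable_diff[OF exp_h exp_\<phi>])
    show "integrable \<mu> (\<lambda>x. exp C * \<bar>\<phi> x - g x\<bar>)"
      by (rule integrable_mult_right) (rule int[OF \<mu>])
    fix x assume "x \<in> space \<mu>"
    then have x: "x \<in> \<Omega>"
      by (simp add: nonneg_measures_space[OF \<mu>])
    then have "h x \<le> C"
      using \<phi>(2)[OF x] by (simp add: h_def)
    then have "exp (h x) - exp (\<phi> x) \<le> exp C * \<bar>h x - \<phi> x\<bar>"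
      by (rule exp_diff_le)
    also have "\<dots> \<le> exp C * \<bar>\<phi> x - g x\<bar>"
      using closer[OF x] by (intro mult_left_mono) auto
    finally have "exp (h x) - exp (\<phi> x) \<le> exp C * \<bar>\<phi> x - g x\<bar>" .
    then show "exp (h x) - 1 - (exp (\<phi> x) - 1) \<le> exp C * \<bar>\<phi> x - g x\<bar>" by simp
  qed
  also have "\<dots> = exp C * (\<integral>x. \<bar>\<phi> x - g x\<bar> \<partial>\<mu>)" by simp
  also have "\<dots> \<le> exp C * \<delta>"
    using small[OF \<mu> N(3)] by (intro mult_left_mono) auto
  finally have "(\<integral>x. exp (h x) - 1 \<partial>\<mu>) - (\<integral>x. exp (\<phi> x) - 1 \<partial>\<mu>) \<le> exp C * \<delta>" .
  with 1 dual[OF h] \<delta>(2) show "(\<integral>x. \<phi> x \<partial>\<alpha>) - (\<integral>x. exp (\<phi> x) - 1 \<partial>\<mu>) \<le> B + e"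
    by (simp add: algebra_simps)
qed

text \<open>On a \<mu>-null set \<open>A\<close> the test function \<open>t * indicator A\<close>
  costs nothing in the exponential term and gains \<open>t * measure \<alpha> A\<close>, which must
  stay below \<open>B\<close> for every \<open>t\<close>.\<close>

lemma kl_dual_absolutely_continuous:
  fixes \<Omega> :: "'a::metric_space set" and B :: real
  assumes compact: "compact \<Omega>" and \<alpha>: "\<alpha> \<in> nonneg_measures \<Omega>" and \<mu>: "\<mu> \<in> nonneg_measures \<Omega>"
    and dual: "\<And>\<phi>. continuous_on \<Omega> \<phi> \<Longrightarrow> (\<integral>x. \<phi> x \<partial>\<alpha>) - (\<integral>x. exp (\<phi> x) - 1 \<partial>\<mu>) \<le> B"
  shows "absolutely_continuous \<mu> \<alpha>"
  unfolding absolutely_continuous_def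
proof
  have sets: "sets \<alpha> = sets \<mu>"
    by (simp add: nonneg_measures_sets[OF \<alpha>] nonneg_measures_sets[OF \<mu>])
  interpret \<alpha>: finite_measure \<alpha> by (rule nonneg_measures_finite[OF \<alpha>])
  fix A assume A: "A \<in> null_sets \<mu>"
  then have A_sets: "A \<in> sets \<mu>" "A \<in> sets \<alpha>" by (auto simp: sets)
  have le: "t * measure \<alpha> A \<le> B" for t
  proof -
    have "(\<integral>x. t * indicator A x \<partial>\<alpha>) - (\<integral>x. exp (t * indicator A x) - 1 \<partial>\<mu>) \<le> B"
      using A_sets(1)
      by (intro kl_dual_bounded_measurable[OF compact \<alpha> \<mu> dual, where C = "\<bar>t\<bar>"])
        (auto simp: indicator_def)
    moreover have "(\<integral>x. exp (t * indicator A x) - 1 \<partial>\<mu>) = (\<integral>x. 0 \<partial>\<mu>)"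
    proof (rule integral_cong_AE)
      show "AE x in \<mu>. exp (t * indicator A x) - 1 = 0"
        using AE_not_in[OF A] by eventually_elim simp
    qed (use A_sets(1) in auto)
    ultimately show ?thesis
      using A_sets(2) by simp
  qed
  have "measure \<alpha> A = 0"
  proof (rule ccontr)
    assume "measure \<alpha> A \<noteq> 0"
    then have "0 < measure \<alpha> A"
      using measure_nonneg[of \<alpha> A] by linarith
    then show False
      using le[of "(B + 1) / measure \<alpha> A"] by simp
  qed
  then show "A \<in> null_sets \<alpha>"
    using A_sets(2) by (intro null_setsI) (auto simp: \<alpha>.emeasure_eq_measure)
qed

text \<open>Fenchel--Young: \<open>exp p - 1\<close> is the convex conjugate of
  \<open>kl_entropy\<close>, with equality at \<open>p = ln s\<close> for positive
  \<open>s\<close>.\<close>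

lemma kl_entropy_Young:
  assumes "0 \<le> s"
  shows "s * p - (exp p - 1) \<le> kl_entropy s"
proof (cases "s = 0")
  case False
  then have s: "0 < s" using assms by simp
  have "s * (1 + (p - ln s)) \<le> s * exp (p - ln s)"
    using s by (intro mult_left_mono exp_ge_add_one_self) auto
  also have "\<dots> = exp p"
    using s by (simp add: exp_diff)
  finally show ?thesis
    using False by (simp add: kl_entropy_def algebra_simps)
qed (simp add: kl_entropy_def)

lemma borel_measurable_kl_entropy [measurable]: "kl_entropy \<in> borel_measurable borel"
  unfolding kl_entropy_def[abs_def] by measurable

section \<open>The two inequalities between the entropy and its dual\<close>

lemma
  assumes \<alpha>: "\<alpha> \<in> nonneg_measures \<Omega>" and \<mu>: "\<mu> \<in> nonneg_measures \<Omega>"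
    and ac: "absolutely_continuous \<mu> \<alpha>" and f: "integrable \<alpha> f"
  shows integrable_RN_deriv: "integrable \<mu> (\<lambda>x. enn2real (RN_deriv \<mu> \<alpha> x) * f x)"
    and integral_RN_deriv: "(\<integral>x. f x \<partial>\<alpha>) = (\<integral>x. enn2real (RN_deriv \<mu> \<alpha> x) * f x \<partial>\<mu> :: real)"
proof -
  have sets: "sets \<alpha> = sets \<mu>"
    by (simp add: nonneg_measures_sets[OF \<alpha>] nonneg_measures_sets[OF \<mu>])
  interpret \<alpha>: finite_measure \<alpha> by (rule nonneg_measures_finite[OF \<alpha>])
  interpret \<mu>: finite_measure \<mu> by (rule nonneg_measures_finite[OF \<mu>])
  have "f \<in> borel_measurable \<mu>"
    using borel_measurable_integrable[OF f] measurable_cong_sets[OF sets refl] by blast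
  then show "integrable \<mu> (\<lambda>x. enn2real (RN_deriv \<mu> \<alpha> x) * f x)"
    and "(\<integral>x. f x \<partial>\<alpha>) = (\<integral>x. enn2real (RN_deriv \<mu> \<alpha> x) * f x \<partial>\<mu>)"
    using \<mu>.RN_deriv_integrable[OF \<alpha>.sigma_finite_measure ac sets] f
      \<mu>.RN_deriv_integral[OF \<alpha>.sigma_finite_measure ac sets] by auto
qed

text \<open>This is the Young inequality integrated against \<mu>, with the density of \<alpha> in
  place of \<open>s\<close>.\<close>

theorem KL_dual_le:
  fixes \<Omega> :: "'a::metric_space set"
  assumes compact: "compact \<Omega>" and \<alpha>: "\<alpha> \<in> nonneg_measures \<Omega>" and \<mu>: "\<mu> \<in> nonneg_measures \<Omega>"
    and \<phi>: "continuous_on \<Omega> \<phi>"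
  shows "ennreal ((\<integral>x. \<phi> x \<partial>\<alpha>) - (\<integral>x. exp (\<phi> x) - 1 \<partial>\<mu>)) \<le> KL \<alpha> \<mu>"
proof (cases "absolutely_continuous \<mu> \<alpha>")
  case False
  then show ?thesis by (simp add: KL_def)
next
  case True
  define D where "D x = enn2real (RN_deriv \<mu> \<alpha> x)" for x
  have int1: "integrable \<mu> (\<lambda>x. D x * \<phi> x)"
    and eq: "(\<integral>x. \<phi> x \<partial>\<alpha>) = (\<integral>x. D x * \<phi> x \<partial>\<mu>)"
    using integrable_RN_deriv[OF \<alpha> \<mu> True continuous_on_integrable[OF \<alpha> compact \<phi>]]
      integral_RN_deriv[OF \<alpha> \<mu> True continuous_on_integrable[OF \<alpha> compact \<phi>]]
    by (simp_all add: D_def)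
  have int2: "integrable \<mu> (\<lambda>x. exp (\<phi> x) - 1)"
    by (intro continuous_on_integrable[OF \<mu> compact] continuous_intros \<phi>)
  define F where "F x = D x * \<phi> x - (exp (\<phi> x) - 1)" for x
  have int: "integrable \<mu> F"
    unfolding F_def using int1 int2 by (rule Bochner_Integration.integrable_diff)
  have "(\<integral>x. \<phi> x \<partial>\<alpha>) - (\<integral>x. exp (\<phi> x) - 1 \<partial>\<mu>) = (\<integral>x. F x \<partial>\<mu>)"
    unfolding eq F_def using int1 int2 by (rule Bochner_Integration.integral_diff[symmetric])
  \<comment> \<open>The Young integrand may be negative, whereas the entropy is a non-negative
    integral; passing to the positive part makes the two comparable.\<close>
  also have "\<dots> \<le> (\<integral>x. max 0 (F x) \<partial>\<mu>)"
    using int by (intro integral_mono) auto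
  finally have "ennreal ((\<integral>x. \<phi> x \<partial>\<alpha>) - (\<integral>x. exp (\<phi> x) - 1 \<partial>\<mu>)) \<le> ennreal (\<integral>x. max 0 (F x) \<partial>\<mu>)"
    by (rule ennreal_leI)
  also have "\<dots> = (\<integral>\<^sup>+x. ennreal (max 0 (F x)) \<partial>\<mu>)"
    using int by (intro nn_integral_eq_integral[symmetric]) auto
  also have "\<dots> \<le> (\<integral>\<^sup>+x. ennreal (kl_entropy (D x)) \<partial>\<mu>)"
  proof (rule nn_integral_mono)
    fix x
    \<comment> \<open>The entropy is non-negative by the Young inequality at
      \<open>p = 0\<close>.\<close>
    have "F x \<le> kl_entropy (D x)" "0 \<le> kl_entropy (D x)"
      using kl_entropy_Young[of "D x" "\<phi> x"] kl_entropy_Young[of "D x" 0]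
      by (simp_all add: F_def D_def)
    then show "ennreal (max 0 (F x)) \<le> ennreal (kl_entropy (D x))"
      by (intro ennreal_leI) simp
  qed
  finally show ?thesis
    using True by (simp add: KL_def D_def)
qed

text \<open>Truncating the optimal test function \<open>ln s\<close> at height \<open>k\<close>.\<close>

definition clamped_ln :: "nat \<Rightarrow> real \<Rightarrow> real" where
  "clamped_ln k s = (if s = 0 then - real k else max (- real k) (min (real k) (ln s)))"

lemma clamped_ln_bound: "\<bar>clamped_ln k s\<bar> \<le> real k"
  by (auto simp: clamped_ln_def)

lemma borel_measurable_clamped_ln [measurable]: "clamped_ln k \<in> borel_measurable borel"
  unfolding clamped_ln_def[abs_def] by measurable

text \<open>The concave function \<open>s * p - (exp p - 1)\<close> of \<open>p\<close> vanishes at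
  0 and increases from there towards its maximum at \<open>ln s\<close>; clamping stops between the
  two. For \<open>s = 0\<close> the maximum is only approached as \<open>p\<close> tends to minus
  infinity. The sign is what Fatou's lemma requires.\<close>

lemma clamped_ln_dual_nonneg:
  assumes "0 \<le> s"
  shows "0 \<le> s * clamped_ln k s - (exp (clamped_ln k s) - 1)"
proof -
  let ?p = "clamped_ln k s"
  have "exp ?p * ?p \<le> s * ?p"
  proof (cases "1 \<le> s")
    case True
    then have "0 \<le> ln s" by simp
    moreover have "- real k \<le> 0" by simp
    ultimately have "0 \<le> ln s" "- real k \<le> ln s" by linarith+
    with True have "0 \<le> ?p" "?p \<le> ln s"
      by (auto simp: clamped_ln_def max_def min_def)
    then have "exp ?p \<le> exp (ln s)" by simp
    then have "exp ?p \<le> s" using True by simp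
    with \<open>0 \<le> ?p\<close> show ?thesis by (intro mult_right_mono)
  next
    case False
    show ?thesis
    proof (cases "s = 0")
      case True
      then show ?thesis by (simp add: clamped_ln_def)
    next
      case s: False
      then have "ln s \<le> 0" using False assms by simp
      moreover have "0 \<le> real k" by simp
      ultimately have "?p \<le> 0" "ln s \<le> ?p"
        using s by (auto simp: clamped_ln_def max_def min_def)
      then have "exp (ln s) \<le> exp ?p" by simp
      then have "s \<le> exp ?p" using s assms by simp
      with \<open>?p \<le> 0\<close> show ?thesis by (intro mult_right_mono_neg)
    qed
  qed
  moreover have "exp ?p * (1 - ?p) \<le> 1"
  proof -
    have "exp ?p * (1 + - ?p) \<le> exp ?p * exp (- ?p)"
      by (intro mult_left_mono exp_ge_add_one_self) auto
    then show ?thesis by (simp add: exp_minus)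
  qed
  ultimately show ?thesis by (simp add: algebra_simps)
qed

text \<open>For \<open>s > 0\<close> the sequence is eventually constant. For \<open>s = 0\<close>
  the special value \<open>- real k\<close> of \<open>clamped_ln\<close> gives
  \<open>1 - exp (- real k)\<close>, tending to \<open>kl_entropy 0 = 1\<close>.\<close>

lemma clamped_ln_dual_tendsto:
  assumes "0 \<le> s"
  shows "(\<lambda>k. s * clamped_ln k s - (exp (clamped_ln k s) - 1)) \<longlonglongrightarrow> kl_entropy s"
proof (cases "s = 0")
  case True
  have "(\<lambda>k. - (exp (- real k) - 1)) \<longlonglongrightarrow> - (0 - 1)"
    by (intro tendsto_intros filterlim_compose[OF exp_at_bot])
      (simp add: filterlim_uminus_at_bot filterlim_real_sequentially)
  then show ?thesis
    using True by (simp add: clamped_ln_def kl_entropy_def)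
next
  case False
  then have s: "0 < s" using assms by simp
  obtain n where n: "\<bar>ln s\<bar> \<le> real n"
    using real_arch_simple by blast
  have "s * clamped_ln k s - (exp (clamped_ln k s) - 1) = kl_entropy s" if "n \<le> k" for k
  proof -
    have "\<bar>ln s\<bar> \<le> real k" using n that by simp
    then have "clamped_ln k s = ln s"
      using s by (auto simp: clamped_ln_def)
    then show ?thesis
      using s by (simp add: kl_entropy_def)
  qed
  then show ?thesis
    by (intro tendsto_eventually eventually_sequentiallyI[of n]) simp
qed

text \<open>Clamped logarithms of the density are admissible test functions and nearly optimal ones.
  A real bound \<open>B\<close> in place of a supremum fits the limit arguments, where each test
  function is treated alone.\<close>

theorem KL_le_dual:
  fixes \<Omega> :: "'a::metric_space set" and B :: real
  assumes compact: "compact \<Omega>" and \<alpha>: "\<alpha> \<in> nonneg_measures \<Omega>" and \<mu>: "\<mu> \<in> nonneg_measures \<Omega>"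
    and dual: "\<And>\<phi>. continuous_on \<Omega> \<phi> \<Longrightarrow> (\<integral>x. \<phi> x \<partial>\<alpha>) - (\<integral>x. exp (\<phi> x) - 1 \<partial>\<mu>) \<le> B"
  shows "KL \<alpha> \<mu> \<le> ennreal B"
proof -
  have ac: "absolutely_continuous \<mu> \<alpha>"
    by (rule kl_dual_absolutely_continuous[OF compact \<alpha> \<mu> dual])
  have sets: "sets \<alpha> = sets \<mu>"
    by (simp add: nonneg_measures_sets[OF \<alpha>] nonneg_measures_sets[OF \<mu>])
  define D where "D x = enn2real (RN_deriv \<mu> \<alpha> x)" for x
  have [measurable]: "D \<in> borel_measurable \<mu>"
    unfolding D_def by measurable
  have D: "0 \<le> D x" for x by (simp add: D_def)
  define F where "F k x = D x * clamped_ln k (D x) - (exp (clamped_ln k (D x)) - 1)" for k x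
  have [measurable]: "F k \<in> borel_measurable \<mu>" for k
    unfolding F_def by measurable
  have F: "(\<integral>\<^sup>+x. ennreal (F k x) \<partial>\<mu>) \<le> ennreal B" for k
  proof -
    let ?\<phi> = "\<lambda>x. clamped_ln k (D x)"
    have \<phi>_\<mu>: "?\<phi> \<in> borel_measurable \<mu>" by measurable
    then have "?\<phi> \<in> borel_measurable \<alpha>"
      using measurable_cong_sets[OF sets refl] by blast
    then have \<phi>_\<alpha>: "integrable \<alpha> ?\<phi>"
      by (rule bounded_measurable_integrable[OF \<alpha>]) (rule clamped_ln_bound)
    have int2: "integrable \<mu> (\<lambda>x. exp (?\<phi> x) - 1)"
      using \<phi>_\<mu>
      by (intro bounded_measurable_integrable[OF \<mu> _ abs_exp_minus_1_le[OF clamped_ln_bound]]) auto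
    have int1: "integrable \<mu> (\<lambda>x. D x * ?\<phi> x)"
      and eq: "(\<integral>x. ?\<phi> x \<partial>\<alpha>) = (\<integral>x. D x * ?\<phi> x \<partial>\<mu>)"
      using integrable_RN_deriv[OF \<alpha> \<mu> ac \<phi>_\<alpha>] integral_RN_deriv[OF \<alpha> \<mu> ac \<phi>_\<alpha>]
      by (simp_all add: D_def)
    have "(\<integral>x. F k x \<partial>\<mu>) = (\<integral>x. ?\<phi> x \<partial>\<alpha>) - (\<integral>x. exp (?\<phi> x) - 1 \<partial>\<mu>)"
      unfolding eq F_def using int1 int2 by (rule Bochner_Integration.integral_diff)
    also have "\<dots> \<le> B"
      by (rule kl_dual_bounded_measurable[OF compact \<alpha> \<mu> dual \<phi>_\<mu> clamped_ln_bound])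
    finally have "(\<integral>x. F k x \<partial>\<mu>) \<le> B" .
    moreover have "integrable \<mu> (F k)"
      unfolding F_def using int1 int2 by (rule Bochner_Integration.integrable_diff)
    then have "(\<integral>\<^sup>+x. ennreal (F k x) \<partial>\<mu>) = ennreal (\<integral>x. F k x \<partial>\<mu>)"
      by (rule nn_integral_eq_integral) (simp add: F_def clamped_ln_dual_nonneg[OF D] del: diff_ge_0_iff_ge)
    ultimately show ?thesis by (simp add: ennreal_leI)
  qed
  \<comment> \<open>Fatou's lemma suffices: the integrands converge pointwise and each integral is
    at most \<open>B\<close>.\<close>
  have "(\<integral>\<^sup>+x. ennreal (kl_entropy (D x)) \<partial>\<mu>) = (\<integral>\<^sup>+x. liminf (\<lambda>k. ennreal (F k x)) \<partial>\<mu>)"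
    using clamped_ln_dual_tendsto[OF D]
    by (intro nn_integral_cong lim_imp_Liminf[symmetric] tendsto_ennrealI)
      (auto simp: F_def)
  also have "\<dots> \<le> liminf (\<lambda>k. \<integral>\<^sup>+x. ennreal (F k x) \<partial>\<mu>)"
    by (rule nn_integral_liminf) measurable
  also have "\<dots> \<le> limsup (\<lambda>k. \<integral>\<^sup>+x. ennreal (F k x) \<partial>\<mu>)"
    by (rule Liminf_le_Limsup) simp
  also have "\<dots> \<le> ennreal B"
    using F by (intro Limsup_bounded) auto
  finally show ?thesis
    using ac by (simp add: KL_def D_def)
qed

section \<open>The Hellinger--Kantorovich distance\<close>

text \<open>The floor \<open>1 / real (Suc k)\<close> keeps the logarithm finite, and the cap at
  \<open>pi / 2\<close> stops the cosine from becoming positive again at large distances.\<close>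

definition hk_cost_trunc :: "real \<Rightarrow> nat \<Rightarrow> 'a::real_normed_vector \<times> 'a \<Rightarrow> real" where
  "hk_cost_trunc \<kappa> k z =
     - 2 * ln (max (1 / real (Suc k)) (cos (min (norm (fst z - snd z) / \<kappa>) (pi / 2))))"

lemma continuous_on_hk_cost_trunc:
  assumes "0 < \<kappa>"
  shows "continuous_on A (hk_cost_trunc \<kappa> k)"
proof -
  have "0 < max (1 / real (Suc k)) c" for c :: real
    by (simp add: less_max_iff_disj)
  then show ?thesis
    unfolding hk_cost_trunc_def[abs_def]
    using assms by (intro continuous_intros) (auto simp: less_le)
qed

lemma hk_cost_trunc_nonneg: "0 \<le> hk_cost_trunc \<kappa> k z"
proof -
  let ?c = "max (1 / real (Suc k)) (cos (min (norm (fst z - snd z) / \<kappa>) (pi / 2)))"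
  have "0 < ?c" "?c \<le> 1" by (auto simp: less_max_iff_disj)
  then show ?thesis
    by (simp add: hk_cost_trunc_def)
qed

lemma incseq_hk_cost_trunc: "incseq (\<lambda>k. hk_cost_trunc \<kappa> k z)"
proof (rule incseq_SucI)
  fix k
  let ?c = "\<lambda>k. max (1 / real (Suc k)) (cos (min (norm (fst z - snd z) / \<kappa>) (pi / 2)))"
  have pos: "0 < ?c k" for k by (simp add: less_max_iff_disj)
  have "1 / real (Suc (Suc k)) \<le> 1 / real (Suc k)"
    by (intro divide_left_mono) auto
  then have "?c (Suc k) \<le> ?c k" by (intro max.mono) auto
  then have "ln (?c (Suc k)) \<le> ln (?c k)"
    using pos[of k] pos[of "Suc k"] by (subst ln_le_cancel_iff) auto
  then show "hk_cost_trunc \<kappa> k z \<le> hk_cost_trunc \<kappa> (Suc k) z"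
    by (simp add: hk_cost_trunc_def)
qed

text \<open>Below the critical distance the floor is inactive once it drops under the cosine. At or
  beyond it the truncation equals \<open>2 * ln (real (Suc k))\<close>, which is unbounded.\<close>

lemma hk_cost_eq_SUP:
  assumes \<kappa>: "0 < \<kappa>"
  shows "hk_cost \<kappa> (fst z) (snd z) = (SUP k. ennreal (hk_cost_trunc \<kappa> k z))"
proof (cases "norm (fst z - snd z) < \<kappa> * pi / 2")
  case True
  define t where "t = norm (fst z - snd z) / \<kappa>"
  have t: "0 \<le> t" "t < pi / 2"
    using True \<kappa> by (auto simp: t_def field_simps)
  then have c: "0 < cos t"
    by (intro cos_gt_zero_pi) auto
  obtain n where n: "1 / real (Suc n) < cos t"
    using nat_approx_posE[OF c] by (auto simp: inverse_eq_divide)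
  have trunc: "hk_cost_trunc \<kappa> k z = - 2 * ln (max (1 / real (Suc k)) (cos t))" for k
    using t by (simp add: hk_cost_trunc_def min_def flip: t_def)
  have "hk_cost_trunc \<kappa> k z \<le> - 2 * ln (cos t)" for k
    using c by (simp add: trunc less_max_iff_disj)
  moreover have "hk_cost_trunc \<kappa> n z = - 2 * ln (cos t)"
    using n by (simp add: trunc max_def)
  ultimately have "(SUP k. ennreal (hk_cost_trunc \<kappa> k z)) = ennreal (- 2 * ln (cos t))"
    by (intro antisym SUP_least SUP_upper2[of n] ennreal_leI) auto
  then show ?thesis
    using True by (simp add: hk_cost_def t_def)
next
  case False
  then have "min (norm (fst z - snd z) / \<kappa>) (pi / 2) = pi / 2"
    using \<kappa> by (simp add: min_def field_simps)
  then have trunc: "hk_cost_trunc \<kappa> k z = 2 * ln (real (Suc k))" for k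
    unfolding hk_cost_trunc_def by (simp only:) (simp add: ln_div)
  have "(SUP k. ennreal (hk_cost_trunc \<kappa> k z)) = top"
  proof (rule ennreal_SUP_eq_top)
    fix n :: nat
    obtain k where "exp (real n) \<le> real k"
      using real_arch_simple by blast
    then have "exp (real n) \<le> real (Suc k)" by simp
    then have "real n \<le> ln (real (Suc k))"
      by (subst ln_ge_iff) auto
    moreover from this have "0 \<le> ln (real (Suc k))"
      using order_trans[of 0 "real n"] by simp
    ultimately have "ennreal (real n) \<le> ennreal (hk_cost_trunc \<kappa> k z)"
      unfolding trunc by (intro ennreal_leI) linarith
    then show "\<exists>k\<in>UNIV. of_nat n \<le> ennreal (hk_cost_trunc \<kappa> k z)"
      by (auto simp: ennreal_of_nat_eq_real_of_nat)
  qed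
  then show ?thesis
    using False by (simp only: hk_cost_def if_False infinity_ennreal_def)
qed

section \<open>Transport plans: cost, marginals and scaling\<close>

lemma
  assumes \<gamma>: "\<gamma> \<in> nonneg_measures (\<Omega> \<times> \<Omega>)" and \<kappa>: "0 < \<kappa>"
  shows borel_measurable_hk_cost: "(\<lambda>z. hk_cost \<kappa> (fst z) (snd z)) \<in> borel_measurable \<gamma>"
    and nn_integral_hk_cost:
      "(\<integral>\<^sup>+z. hk_cost \<kappa> (fst z) (snd z) \<partial>\<gamma>) = (SUP k. \<integral>\<^sup>+z. ennreal (hk_cost_trunc \<kappa> k z) \<partial>\<gamma>)"
proof -
  have meas: "(\<lambda>z. ennreal (hk_cost_trunc \<kappa> k z)) \<in> borel_measurable \<gamma>" for k
    using continuous_on_borel_measurable[OF \<gamma> continuous_on_hk_cost_trunc[OF \<kappa>]] by measurable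
  then show "(\<lambda>z. hk_cost \<kappa> (fst z) (snd z)) \<in> borel_measurable \<gamma>"
    unfolding hk_cost_eq_SUP[OF \<kappa>] by (intro borel_measurable_SUP) auto
  show "(\<integral>\<^sup>+z. hk_cost \<kappa> (fst z) (snd z) \<partial>\<gamma>) = (SUP k. \<integral>\<^sup>+z. ennreal (hk_cost_trunc \<kappa> k z) \<partial>\<gamma>)"
    unfolding hk_cost_eq_SUP[OF \<kappa>]
    using meas
    by (intro nn_integral_monotone_convergence_SUP)
      (auto simp: incseq_def le_fun_def intro!: ennreal_leI incseqD[OF incseq_hk_cost_trunc])
qed

lemma
  assumes \<gamma>: "\<gamma> \<in> nonneg_measures (A \<times> B)"
  shows measurable_fst_nonneg: "fst \<in> measurable \<gamma> (restrict_space borel A)"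
    and measurable_snd_nonneg: "snd \<in> measurable \<gamma> (restrict_space borel B)"
proof -
  have "fst \<in> borel_measurable \<gamma>" "snd \<in> borel_measurable \<gamma>"
    by (rule continuous_on_borel_measurable[OF \<gamma>], intro continuous_intros)+
  moreover have "fst \<in> space \<gamma> \<rightarrow> A" "snd \<in> space \<gamma> \<rightarrow> B"
    unfolding nonneg_measures_space[OF \<gamma>] by auto
  ultimately show "fst \<in> measurable \<gamma> (restrict_space borel A)"
    "snd \<in> measurable \<gamma> (restrict_space borel B)"
    by (auto intro: measurable_restrict_space2)
qed

lemma
  assumes \<gamma>: "\<gamma> \<in> nonneg_measures Z" and T: "T \<in> measurable \<gamma> (restrict_space borel \<Omega>)"
  shows distr_in_nonneg_measures: "distr \<gamma> (restrict_space borel \<Omega>) T \<in> nonneg_measures \<Omega>"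
    and measure_distr_total: "measure (distr \<gamma> (restrict_space borel \<Omega>) T) \<Omega> = measure \<gamma> Z"
    and integral_distr_continuous: "continuous_on \<Omega> f \<Longrightarrow>
      (\<integral>x. f x \<partial>distr \<gamma> (restrict_space borel \<Omega>) T) = (\<integral>z. f (T z) \<partial>\<gamma> :: real)"
    and distr_density_const: "distr (density \<gamma> (\<lambda>_. c)) (restrict_space borel \<Omega>) T =
      density (distr \<gamma> (restrict_space borel \<Omega>) T) (\<lambda>_. c)"
proof -
  interpret finite_measure \<gamma> by (rule nonneg_measures_finite[OF \<gamma>])
  show "distr \<gamma> (restrict_space borel \<Omega>) T \<in> nonneg_measures \<Omega>"
    using finite_measure_distr[OF T] by (simp add: nonneg_measures_def)
  have \<Omega>: "\<Omega> \<in> sets (restrict_space borel \<Omega>)"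
    using sets.top[of "restrict_space borel \<Omega>"] by (simp add: space_restrict_space)
  have "T -` \<Omega> \<inter> space \<gamma> = Z"
    using measurable_space[OF T] by (auto simp: space_restrict_space nonneg_measures_space[OF \<gamma>])
  then show "measure (distr \<gamma> (restrict_space borel \<Omega>) T) \<Omega> = measure \<gamma> Z"
    by (simp add: measure_distr[OF T \<Omega>])
  show "(\<integral>x. f x \<partial>distr \<gamma> (restrict_space borel \<Omega>) T) = (\<integral>z. f (T z) \<partial>\<gamma>)" if "continuous_on \<Omega> f"
    using borel_measurable_continuous_on_restrict[OF that] by (intro integral_distr T)
  show "distr (density \<gamma> (\<lambda>_. c)) (restrict_space borel \<Omega>) T =
      density (distr \<gamma> (restrict_space borel \<Omega>) T) (\<lambda>_. c)"
  proof (rule measure_eqI)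
    fix A assume "A \<in> sets (distr (density \<gamma> (\<lambda>_. c)) (restrict_space borel \<Omega>) T)"
    then have A: "A \<in> sets (restrict_space borel \<Omega>)" by simp
    have T': "T \<in> measurable (density \<gamma> (\<lambda>_. c)) (restrict_space borel \<Omega>)"
      using T by simp
    show "emeasure (distr (density \<gamma> (\<lambda>_. c)) (restrict_space borel \<Omega>) T) A =
        emeasure (density (distr \<gamma> (restrict_space borel \<Omega>) T) (\<lambda>_. c)) A"
      using A measurable_sets[OF T A]
      by (simp add: emeasure_distr[OF T' A] emeasure_distr[OF T A] emeasure_density_const)
  qed simp
qed

definition hk_plan_value ::
    "'a::euclidean_space set \<Rightarrow> real \<Rightarrow> 'a measure \<Rightarrow> 'a measure \<Rightarrow> ('a \<times> 'a) measure \<Rightarrow> ennreal" where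
  "hk_plan_value \<Omega> \<kappa> \<mu> \<nu> \<gamma> = (\<integral>\<^sup>+z. hk_cost \<kappa> (fst z) (snd z) \<partial>\<gamma>)
     + KL (distr \<gamma> (restrict_space borel \<Omega>) fst) \<mu>
     + KL (distr \<gamma> (restrict_space borel \<Omega>) snd) \<nu>"

lemma HK_squared_le: "\<gamma> \<in> nonneg_measures (\<Omega> \<times> \<Omega>) \<Longrightarrow> HK_squared \<Omega> \<kappa> \<mu> \<nu> \<le> hk_plan_value \<Omega> \<kappa> \<mu> \<nu> \<gamma>"
  unfolding HK_squared_def hk_plan_value_def by (rule INF_lower)

text \<open>A strict bound replaces an optimal plan. Naming the three terms as reals moves all later
  estimates out of \<open>ennreal\<close>.\<close>

lemma HK_squared_less_obtain:
  assumes "HK_squared \<Omega> \<kappa> \<mu> \<nu> < ennreal a"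
  obtains \<gamma> c k\<^sub>1 k\<^sub>2 where "\<gamma> \<in> nonneg_measures (\<Omega> \<times> \<Omega>)" "0 \<le> c" "0 \<le> k\<^sub>1" "0 \<le> k\<^sub>2" "c + k\<^sub>1 + k\<^sub>2 \<le> a"
    "(\<integral>\<^sup>+z. hk_cost \<kappa> (fst z) (snd z) \<partial>\<gamma>) = ennreal c"
    "KL (distr \<gamma> (restrict_space borel \<Omega>) fst) \<mu> = ennreal k\<^sub>1"
    "KL (distr \<gamma> (restrict_space borel \<Omega>) snd) \<nu> = ennreal k\<^sub>2"
proof -
  obtain \<gamma> where \<gamma>: "\<gamma> \<in> nonneg_measures (\<Omega> \<times> \<Omega>)" "hk_plan_value \<Omega> \<kappa> \<mu> \<nu> \<gamma> < ennreal a"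
    using assms by (auto simp: HK_squared_def INF_less_iff hk_plan_value_def)
  let ?c = "\<integral>\<^sup>+z. hk_cost \<kappa> (fst z) (snd z) \<partial>\<gamma>"
  let ?k1 = "KL (distr \<gamma> (restrict_space borel \<Omega>) fst) \<mu>"
  let ?k2 = "KL (distr \<gamma> (restrict_space borel \<Omega>) snd) \<nu>"
  have less: "?c + ?k1 + ?k2 < ennreal a"
    using \<gamma>(2) by (simp add: hk_plan_value_def)
  then have "?c + ?k1 + ?k2 < top"
    using ennreal_less_top less_trans by blast
  then have fin: "ennreal (enn2real ?c) = ?c" "ennreal (enn2real ?k1) = ?k1" "ennreal (enn2real ?k2) = ?k2"
    by (auto simp: ennreal_enn2real_if less_top)
  have "ennreal (enn2real ?c + enn2real ?k1 + enn2real ?k2) < ennreal a"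
    using less by (simp add: ennreal_plus fin)
  then have "enn2real ?c + enn2real ?k1 + enn2real ?k2 \<le> a"
    by (subst (asm) ennreal_less_iff) auto
  then show ?thesis
    using that[OF \<gamma>(1), of "enn2real ?c" "enn2real ?k1" "enn2real ?k2"] fin by simp
qed

text \<open>Test function 1 in the dual inequality, whence the factor
  \<open>exp 1 - 1\<close>.\<close>

lemma KL_mass_bound:
  fixes \<Omega> :: "'a::metric_space set"
  assumes compact: "compact \<Omega>" and \<alpha>: "\<alpha> \<in> nonneg_measures \<Omega>" and \<mu>: "\<mu> \<in> nonneg_measures \<Omega>"
    and KL: "KL \<alpha> \<mu> \<le> ennreal B" "0 \<le> B"
  shows "measure \<alpha> \<Omega> \<le> B + (exp 1 - 1) * measure \<mu> \<Omega>"
proof -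
  have "ennreal ((\<integral>x. 1 \<partial>\<alpha>) - (\<integral>x. exp 1 - 1 \<partial>\<mu>)) \<le> ennreal B"
    using KL_dual_le[OF compact \<alpha> \<mu>, of "\<lambda>_. 1"] KL(1) by auto
  then have "(\<integral>x. 1 \<partial>\<alpha>) - (\<integral>x. exp 1 - 1 \<partial>\<mu>) \<le> B"
    using KL(2) by (simp add: ennreal_le_iff)
  then show ?thesis
    by (simp add: nonneg_measures_space[OF \<alpha>] nonneg_measures_space[OF \<mu>] algebra_simps)
qed

text \<open>Scaling multiplies the density by \<open>\<sigma> / r\<close>, so test functions are
  shifted by \<open>ln (\<sigma> / r)\<close>; this turns the scaled dual functional into \<sigma>
  times the old one plus constants. If \<open>B\<close> is the entropy itself, \<open>V\<close> is
  the exact entropy after scaling.\<close>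

lemma KL_scaled:
  fixes \<Omega> :: "'a::metric_space set"
  assumes compact: "compact \<Omega>" and \<alpha>: "\<alpha> \<in> nonneg_measures \<Omega>" and \<mu>: "\<mu> \<in> nonneg_measures \<Omega>"
    and \<sigma>: "0 < \<sigma>" and r: "0 < r" and KL: "KL \<alpha> \<mu> \<le> ennreal B" "0 \<le> B"
  defines "V \<equiv> \<sigma> * B + \<sigma> * ln (\<sigma> / r) * measure \<alpha> \<Omega> + (r - \<sigma>) * measure \<mu> \<Omega>"
  shows "KL (density \<alpha> (\<lambda>_. ennreal \<sigma>)) (density \<mu> (\<lambda>_. ennreal r)) \<le> ennreal V" and "0 \<le> V"
proof -
  have dual: "(\<integral>x. \<phi> x \<partial>density \<alpha> (\<lambda>_. ennreal \<sigma>)) - (\<integral>x. exp (\<phi> x) - 1 \<partial>density \<mu> (\<lambda>_. ennreal r)) \<le> V"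
    if \<phi>: "continuous_on \<Omega> \<phi>" for \<phi>
  proof -
    define l where "l = ln (\<sigma> / r)"
    have exp_l: "exp (- l) = r / \<sigma>"
      using \<sigma> r by (simp add: l_def exp_minus)
    have e: "continuous_on \<Omega> (\<lambda>x. exp (\<phi> x))" and \<psi>: "continuous_on \<Omega> (\<lambda>x. \<phi> x - l)"
      by (intro continuous_intros \<phi>)+
    have "continuous_on \<Omega> (\<lambda>_. c)" for c :: real by (rule continuous_on_const)
    note int = continuous_on_integrable[OF \<alpha> compact \<phi>] continuous_on_integrable[OF \<mu> compact e]
      continuous_on_integrable[OF \<alpha> compact this] continuous_on_integrable[OF \<mu> compact this]
    have "ennreal ((\<integral>x. \<phi> x - l \<partial>\<alpha>) - (\<integral>x. exp (\<phi> x - l) - 1 \<partial>\<mu>)) \<le> ennreal B"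
      using KL_dual_le[OF compact \<alpha> \<mu> \<psi>] KL(1) by (rule order_trans)
    then have "(\<integral>x. \<phi> x - l \<partial>\<alpha>) - (\<integral>x. exp (\<phi> x - l) - 1 \<partial>\<mu>) \<le> B"
      using KL(2) by (simp add: ennreal_le_iff)
    moreover have "(\<integral>x. \<phi> x - l \<partial>\<alpha>) = (\<integral>x. \<phi> x \<partial>\<alpha>) - l * measure \<alpha> \<Omega>"
      using int by (simp add: nonneg_measures_space[OF \<alpha>])
    moreover have "(\<integral>x. exp (\<phi> x - l) - 1 \<partial>\<mu>) = r / \<sigma> * (\<integral>x. exp (\<phi> x) \<partial>\<mu>) - measure \<mu> \<Omega>"
    proof -
      have "(\<integral>x. exp (\<phi> x - l) - 1 \<partial>\<mu>) = (\<integral>x. r / \<sigma> * exp (\<phi> x) - 1 \<partial>\<mu>)"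
        unfolding exp_l[symmetric] by (simp add: exp_diff exp_minus field_simps)
      also have "\<dots> = r / \<sigma> * (\<integral>x. exp (\<phi> x) \<partial>\<mu>) - measure \<mu> \<Omega>"
        using int by (subst Bochner_Integration.integral_diff) (auto simp: nonneg_measures_space[OF \<mu>])
      finally show ?thesis .
    qed
    ultimately have "\<sigma> * ((\<integral>x. \<phi> x \<partial>\<alpha>) - l * measure \<alpha> \<Omega>
        - (r / \<sigma> * (\<integral>x. exp (\<phi> x) \<partial>\<mu>) - measure \<mu> \<Omega>)) \<le> \<sigma> * B"
      using \<sigma> by (intro mult_left_mono) auto
    then have "\<sigma> * (\<integral>x. \<phi> x \<partial>\<alpha>) - r * (\<integral>x. exp (\<phi> x) \<partial>\<mu>) + r * measure \<mu> \<Omega> \<le> V"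
      using \<sigma> by (simp add: V_def algebra_simps flip: l_def)
    moreover have "(\<integral>x. exp (\<phi> x) - 1 \<partial>density \<mu> (\<lambda>_. ennreal r)) = r * (\<integral>x. exp (\<phi> x) - 1 \<partial>\<mu>)"
      using r by (intro integral_scaled[OF \<mu>] continuous_intros \<phi>) auto
    moreover have "(\<integral>x. exp (\<phi> x) - 1 \<partial>\<mu>) = (\<integral>x. exp (\<phi> x) \<partial>\<mu>) - measure \<mu> \<Omega>"
      using int by (simp add: nonneg_measures_space[OF \<mu>])
    ultimately show ?thesis
      using \<sigma> by (simp add: integral_scaled[OF \<alpha> _ \<phi>] algebra_simps)
  qed
  show "KL (density \<alpha> (\<lambda>_. ennreal \<sigma>)) (density \<mu> (\<lambda>_. ennreal r)) \<le> ennreal V"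
    using \<sigma> r by (intro KL_le_dual[OF compact] scaled_in_nonneg_measures[OF \<alpha>]
      scaled_in_nonneg_measures[OF \<mu>] dual) auto
  show "0 \<le> V"
    using dual[of "\<lambda>_. 0"] by simp
qed

text \<open>Scaling a plan by \<open>sqrt r\<close> when its second target is scaled by \<open>r\<close> makes the logarithmic terms of
  the two entropies cancel.\<close>

lemma HK_squared_shrink:
  fixes \<Omega> :: "'a::euclidean_space set"
  assumes compact: "compact \<Omega>" and \<kappa>: "0 < \<kappa>" and M: "0 < M" and \<mu>: "\<mu> \<in> bounded_measures \<Omega> M"
    and \<nu>: "\<nu> \<in> nonneg_measures \<Omega>" and mass: "M < measure \<nu> \<Omega>"
  shows "HK_squared \<Omega> \<kappa> \<mu> (density \<nu> (\<lambda>_. ennreal (M / measure \<nu> \<Omega>))) \<le> HK_squared \<Omega> \<kappa> \<mu> \<nu>"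
proof (rule ennreal_le_epsilon)
  fix e :: real assume fin: "HK_squared \<Omega> \<kappa> \<mu> \<nu> < top" and e: "0 < e"
  define m r \<sigma> where "m = measure \<nu> \<Omega>" and "r = M / m" and "\<sigma> = sqrt r"
  define a where "a = enn2real (HK_squared \<Omega> \<kappa> \<mu> \<nu>) + e"
  have \<mu>': "\<mu> \<in> nonneg_measures \<Omega>" and \<mu>_le: "measure \<mu> \<Omega> \<le> M"
    using \<mu> by (auto simp: bounded_measures_def)
  have m: "0 < m" "M < m" using M mass by (auto simp: m_def)
  then have r: "0 < r" "r < 1" using M by (auto simp: r_def)
  then have \<sigma>: "0 < \<sigma>" "\<sigma> < 1" "r = \<sigma> * \<sigma>" by (auto simp: \<sigma>_def)
  have a: "HK_squared \<Omega> \<kappa> \<mu> \<nu> + ennreal e = ennreal a"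
    using fin e by (simp add: a_def ennreal_plus ennreal_enn2real_if less_top)
  have "HK_squared \<Omega> \<kappa> \<mu> \<nu> < ennreal a"
    using fin e unfolding a_def
    by (subst ennreal_enn2real[symmetric]) (auto intro!: ennreal_lessI add_nonneg_pos simp: less_top)
  then obtain \<gamma> c k1 k2 where \<gamma>: "\<gamma> \<in> nonneg_measures (\<Omega> \<times> \<Omega>)"
    and nonneg: "0 \<le> c" "0 \<le> k1" "0 \<le> k2" and sum: "c + k1 + k2 \<le> a"
    and c: "(\<integral>\<^sup>+z. hk_cost \<kappa> (fst z) (snd z) \<partial>\<gamma>) = ennreal c"
    and k1: "KL (distr \<gamma> (restrict_space borel \<Omega>) fst) \<mu> = ennreal k1"
    and k2: "KL (distr \<gamma> (restrict_space borel \<Omega>) snd) \<nu> = ennreal k2"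
    by (rule HK_squared_less_obtain)
  define \<gamma>' where "\<gamma>' = density \<gamma> (\<lambda>_. ennreal \<sigma>)"
  define g where "g = measure \<gamma> (\<Omega> \<times> \<Omega>)"
  note fst = measurable_fst_nonneg[OF \<gamma>] and snd = measurable_snd_nonneg[OF \<gamma>]
  have \<gamma>': "\<gamma>' \<in> nonneg_measures (\<Omega> \<times> \<Omega>)"
    unfolding \<gamma>'_def using \<sigma>(1) by (intro scaled_in_nonneg_measures[OF \<gamma>]) simp
  have c': "(\<integral>\<^sup>+z. hk_cost \<kappa> (fst z) (snd z) \<partial>\<gamma>') = ennreal (\<sigma> * c)"
    unfolding \<gamma>'_def using borel_measurable_hk_cost[OF \<gamma> \<kappa>] \<sigma>(1) nonneg(1) c
    by (simp add: nn_integral_density nn_integral_cmult ennreal_mult)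
  \<comment> \<open>The first target stays unscaled, so \<open>r = 1\<close> in the scaling
    formula.\<close>
  define V1 where "V1 = \<sigma> * k1 + \<sigma> * ln \<sigma> * g + (1 - \<sigma>) * measure \<mu> \<Omega>"
  have V1: "KL (distr \<gamma>' (restrict_space borel \<Omega>) fst) \<mu> \<le> ennreal V1" "0 \<le> V1"
    using KL_scaled[OF compact distr_in_nonneg_measures[OF \<gamma> fst] \<mu>' \<sigma>(1) zero_less_one eq_refl[OF k1] nonneg(2)]
    by (simp_all add: \<gamma>'_def distr_density_const[OF \<gamma> fst] measure_distr_total[OF \<gamma> fst] V1_def g_def density_1)
  define V2 where "V2 = \<sigma> * k2 + \<sigma> * ln (\<sigma> / r) * g + (r - \<sigma>) * m"
  have V2: "KL (distr \<gamma>' (restrict_space borel \<Omega>) snd) (density \<nu> (\<lambda>_. ennreal r)) \<le> ennreal V2" "0 \<le> V2"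
    using KL_scaled[OF compact distr_in_nonneg_measures[OF \<gamma> snd] \<nu> \<sigma>(1) r(1) eq_refl[OF k2] nonneg(3)]
    by (simp_all add: \<gamma>'_def distr_density_const[OF \<gamma> snd] measure_distr_total[OF \<gamma> snd] V2_def g_def m_def)
  have "ln (\<sigma> / r) = - ln \<sigma>"
    using \<sigma> by (simp add: ln_div ln_mult)
  then have "V1 + V2 = \<sigma> * (k1 + k2) + (1 - \<sigma>) * (measure \<mu> \<Omega> - \<sigma> * m)"
    by (simp add: V1_def V2_def \<sigma>(3) algebra_simps)
  \<comment> \<open>The mass terms left after the cancellation have the right sign: the mass of
    \<mu> is at most \<open>M = \<sigma> * \<sigma> * m\<close>, which is at most
    \<open>\<sigma> * m\<close>.\<close>
  moreover have "(1 - \<sigma>) * (measure \<mu> \<Omega> - \<sigma> * m) \<le> 0"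
  proof -
    have "M = r * m" using m by (simp add: r_def)
    also have "\<dots> \<le> \<sigma> * m"
      unfolding \<sigma>(3) using \<sigma>(1,2) m by (simp add: mult_le_cancel_left2)
    finally show ?thesis
      using \<mu>_le \<sigma>(2) by (intro mult_nonneg_nonpos) auto
  qed
  moreover have "\<sigma> * (c + k1 + k2) \<le> 1 * (c + k1 + k2)"
    using \<sigma>(2) nonneg by (intro mult_right_mono) auto
  ultimately have total: "\<sigma> * c + V1 + V2 \<le> a"
    using sum by (simp add: algebra_simps)
  have "HK_squared \<Omega> \<kappa> \<mu> (density \<nu> (\<lambda>_. ennreal r)) \<le>
      hk_plan_value \<Omega> \<kappa> \<mu> (density \<nu> (\<lambda>_. ennreal r)) \<gamma>'"
    by (rule HK_squared_le[OF \<gamma>'])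
  also have "\<dots> \<le> ennreal (\<sigma> * c) + ennreal V1 + ennreal V2"
    unfolding hk_plan_value_def c' using V1(1) V2(1) by (intro add_mono) auto
  also have "\<dots> = ennreal (\<sigma> * c + V1 + V2)"
    using \<sigma>(1) nonneg(1) V1(2) V2(2) by (simp add: ennreal_plus)
  also have "\<dots> \<le> HK_squared \<Omega> \<kappa> \<mu> \<nu> + ennreal e"
    unfolding a by (rule ennreal_leI[OF total])
  finally show "HK_squared \<Omega> \<kappa> \<mu> (density \<nu> (\<lambda>_. ennreal (M / measure \<nu> \<Omega>)))
      \<le> HK_squared \<Omega> \<kappa> \<mu> \<nu> + ennreal e"
    by (simp add: r_def m_def)
qed

text \<open>A plan has the mass of its first marginal, which the entropy against \<open>X n\<close>
  controls. The limit of the plans is then a competitor for the limit measures.\<close>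

theorem HK_squared_limit_le:
  fixes \<Omega> :: "'a::euclidean_space set"
  assumes \<Omega>: "compact \<Omega>" "convex \<Omega>" "\<Omega> \<noteq> {}" and \<kappa>: "0 < \<kappa>"
    and X: "\<And>n. X n \<in> bounded_measures \<Omega> M" "weak_star_converges \<Omega> X \<mu>" "\<mu> \<in> bounded_measures \<Omega> M"
    and Y: "\<And>n. Y n \<in> bounded_measures \<Omega> M" "weak_star_converges \<Omega> Y \<nu>" "\<nu> \<in> bounded_measures \<Omega> M"
    and less: "\<And>n. HK_squared \<Omega> \<kappa> (X n) (Y n) < ennreal a"
  shows "HK_squared \<Omega> \<kappa> \<mu> \<nu> \<le> ennreal a"
proof -
  let ?D = "restrict_space borel \<Omega>"
  have nonneg: "X n \<in> nonneg_measures \<Omega>" "Y n \<in> nonneg_measures \<Omega>"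
    "\<mu> \<in> nonneg_measures \<Omega>" "\<nu> \<in> nonneg_measures \<Omega>" and X_le: "measure (X n) \<Omega> \<le> M" for n
    using X(1)[of n] Y(1)[of n] X(3) Y(3) by (auto simp: bounded_measures_def)
  define Q where "Q n \<gamma> c k1 k2 \<longleftrightarrow>
    \<gamma> \<in> nonneg_measures (\<Omega> \<times> \<Omega>) \<and> 0 \<le> c \<and> 0 \<le> k1 \<and> 0 \<le> k2 \<and> c + k1 + k2 \<le> a \<and>
    (\<integral>\<^sup>+z. hk_cost \<kappa> (fst z) (snd z) \<partial>\<gamma>) = ennreal c \<and>
    KL (distr \<gamma> ?D fst) (X n) = ennreal k1 \<and> KL (distr \<gamma> ?D snd) (Y n) = ennreal k2" for n \<gamma> c k1 k2
  have "\<exists>\<gamma> c k1 k2. Q n \<gamma> c k1 k2" for n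
    unfolding Q_def by (rule HK_squared_less_obtain[OF less[of n]]) blast
  then obtain G c k1 k2 where Q: "\<And>n. Q n (G n) (c n) (k1 n) (k2 n)"
    by metis
  have G: "G n \<in> nonneg_measures (\<Omega> \<times> \<Omega>)"
    and pos: "0 \<le> c n" "0 \<le> k1 n" "0 \<le> k2 n" and sum: "c n + k1 n + k2 n \<le> a"
    and c: "(\<integral>\<^sup>+z. hk_cost \<kappa> (fst z) (snd z) \<partial>G n) = ennreal (c n)"
    and k1: "KL (distr (G n) ?D fst) (X n) = ennreal (k1 n)"
    and k2: "KL (distr (G n) ?D snd) (Y n) = ennreal (k2 n)" for n
    using Q[of n] unfolding Q_def by blast+
  have le_a: "c n \<le> a" "k1 n \<le> a" "k2 n \<le> a" for n
    using pos[of n] sum[of n] by linarith+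
  \<comment> \<open>The three terms are made to converge separately: semicontinuity bounds each by
    its own limit, and only the limits are added.\<close>
  have "bounded (range (\<lambda>n. (c n, k1 n, k2 n)))"
    by (rule bounded_subset[of "{0..a} \<times> {0..a} \<times> {0..a}"])
      (use pos le_a in \<open>auto intro!: bounded_Times\<close>)
  then obtain l r1 where r1: "strict_mono (r1 :: nat \<Rightarrow> nat)"
    and l: "((\<lambda>n. (c n, k1 n, k2 n)) \<circ> r1) \<longlonglongrightarrow> l"
    using bounded_imp_convergent_subsequence by blast
  \<comment> \<open>The mass bound from the entropy, with \<open>k1 n\<close> at most
    \<open>a\<close> and the mass of \<open>X n\<close> at most \<open>M\<close>.\<close>
  define B where "B = a + (exp 1 - 1) * M"
  have "G n \<in> bounded_measures (\<Omega> \<times> \<Omega>) B" for n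
  proof -
    have "measure (G n) (\<Omega> \<times> \<Omega>) \<le> k1 n + (exp 1 - 1) * measure (X n) \<Omega>"
      using KL_mass_bound[OF \<Omega>(1) distr_in_nonneg_measures[OF G measurable_fst_nonneg[OF G]]
          nonneg(1) eq_refl[OF k1] pos(2)]
      by (simp add: measure_distr_total[OF G measurable_fst_nonneg[OF G]])
    also have "\<dots> \<le> B"
      unfolding B_def using le_a(2) X_le by (intro add_mono mult_left_mono) auto
    finally show ?thesis
      using G by (simp add: bounded_measures_def)
  qed
  then obtain r2 \<gamma> where r2: "strict_mono (r2 :: nat \<Rightarrow> nat)"
    and \<gamma>: "\<gamma> \<in> bounded_measures (\<Omega> \<times> \<Omega>) B"
    and conv: "weak_star_converges (\<Omega> \<times> \<Omega>) ((G \<circ> r1) \<circ> r2) \<gamma>"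
    using bounded_measures_sequentially_compact[of "\<Omega> \<times> \<Omega>" "G \<circ> r1" B] \<Omega>
    by (auto simp: compact_Times convex_Times)
  define r where "r = r1 \<circ> r2"
  have r: "strict_mono r"
    unfolding r_def using r1 r2 by (rule strict_mono_o)
  have conv: "weak_star_converges (\<Omega> \<times> \<Omega>) (G \<circ> r) \<gamma>"
    using conv by (simp add: r_def o_assoc)
  obtain lc l1 l2 where l_eq: "l = (lc, l1, l2)"
    by (rule prod_cases3)
  have l': "(\<lambda>n. (c (r n), k1 (r n), k2 (r n))) \<longlonglongrightarrow> (lc, l1, l2)"
    using LIMSEQ_subseq_LIMSEQ[OF l r2] by (simp add: r_def o_def l_eq)
  have lim: "(\<lambda>n. c (r n)) \<longlonglongrightarrow> lc" "(\<lambda>n. k1 (r n)) \<longlonglongrightarrow> l1" "(\<lambda>n. k2 (r n)) \<longlonglongrightarrow> l2"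
    using tendsto_fst[OF l'] tendsto_fst[OF tendsto_snd[OF l']] tendsto_snd[OF tendsto_snd[OF l']]
    by simp_all
  have \<gamma>: "\<gamma> \<in> nonneg_measures (\<Omega> \<times> \<Omega>)"
    using \<gamma> by (simp add: bounded_measures_def)
  have lc: "(\<integral>\<^sup>+z. hk_cost \<kappa> (fst z) (snd z) \<partial>\<gamma>) \<le> ennreal lc"
    unfolding nn_integral_hk_cost[OF \<gamma> \<kappa>]
  proof (rule SUP_least)
    fix k
    let ?h = "hk_cost_trunc \<kappa> k :: 'a \<times> 'a \<Rightarrow> real"
    have h: "continuous_on (\<Omega> \<times> \<Omega>) ?h"
      by (rule continuous_on_hk_cost_trunc[OF \<kappa>])
    have eq: "(\<integral>\<^sup>+z. ennreal (?h z) \<partial>\<rho>) = ennreal (\<integral>z. ?h z \<partial>\<rho>)"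
      if "\<rho> \<in> nonneg_measures (\<Omega> \<times> \<Omega>)" for \<rho>
      using continuous_on_integrable[OF that compact_Times[OF \<Omega>(1,1)] h]
      by (intro nn_integral_eq_integral) (auto simp: hk_cost_trunc_nonneg)
    have "(\<integral>z. ?h z \<partial>G n) \<le> c n" for n
    proof -
      have "ennreal (\<integral>z. ?h z \<partial>G n) \<le> ennreal (c n)"
        unfolding eq[OF G, symmetric] c[symmetric] nn_integral_hk_cost[OF G \<kappa>]
        by (rule SUP_upper) simp
      then show ?thesis
        using pos(1) by (simp add: ennreal_le_iff)
    qed
    then have "(\<integral>z. ?h z \<partial>\<gamma>) \<le> lc"
      using weak_star_convergesD[OF conv h] lim(1)
      by (intro LIMSEQ_le[of "\<lambda>n. \<integral>z. ?h z \<partial>(G \<circ> r) n"]) auto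
    then show "(\<integral>\<^sup>+z. ennreal (?h z) \<partial>\<gamma>) \<le> ennreal lc"
      unfolding eq[OF \<gamma>] by (rule ennreal_leI)
  qed
  \<comment> \<open>A general \<open>T\<close> serves both projections. For fixed \<phi> the dual
    functional passes to the limit although plan and target move together, since \<phi> composed
    with \<open>T\<close> is continuous on the product.\<close>
  have KL_limit: "KL (distr \<gamma> ?D T) \<rho> \<le> ennreal lk"
    if T: "continuous_on (\<Omega> \<times> \<Omega>) T" "T \<in> \<Omega> \<times> \<Omega> \<rightarrow> \<Omega>"
      and Z: "\<And>n. Z n \<in> nonneg_measures \<Omega>" "weak_star_converges \<Omega> Z \<rho>" "\<rho> \<in> nonneg_measures \<Omega>"
      and k: "\<And>n. KL (distr (G n) ?D T) (Z n) = ennreal (k n)" "\<And>n. 0 \<le> k n" "(\<lambda>n. k (r n)) \<longlonglongrightarrow> lk"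
    for T Z \<rho> k lk
  proof (rule KL_le_dual[OF \<Omega>(1) _ Z(3)])
    have T_meas: "T \<in> measurable \<eta> ?D" if "\<eta> \<in> nonneg_measures (\<Omega> \<times> \<Omega>)" for \<eta>
      using continuous_on_borel_measurable[OF that T(1)] T(2)
      by (intro measurable_restrict_space2) (simp_all add: nonneg_measures_space[OF that])
    show "distr \<gamma> ?D T \<in> nonneg_measures \<Omega>"
      by (rule distr_in_nonneg_measures[OF \<gamma> T_meas[OF \<gamma>]])
    fix \<phi> :: "'a \<Rightarrow> real" assume \<phi>: "continuous_on \<Omega> \<phi>"
    have e: "continuous_on \<Omega> (\<lambda>x. exp (\<phi> x) - 1)"
      by (intro continuous_intros \<phi>)
    have \<phi>T: "continuous_on (\<Omega> \<times> \<Omega>) (\<lambda>z. \<phi> (T z))"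
      using T(2) by (intro continuous_on_compose2[OF \<phi> T(1)]) auto
    have "(\<integral>z. \<phi> (T z) \<partial>G n) - (\<integral>x. exp (\<phi> x) - 1 \<partial>Z n) \<le> k n" for n
    proof -
      have "ennreal ((\<integral>x. \<phi> x \<partial>distr (G n) ?D T) - (\<integral>x. exp (\<phi> x) - 1 \<partial>Z n)) \<le> ennreal (k n)"
        unfolding k(1)[symmetric]
        by (rule KL_dual_le[OF \<Omega>(1) distr_in_nonneg_measures[OF G T_meas[OF G]] Z(1) \<phi>])
      then show ?thesis
        using k(2) by (simp add: ennreal_le_iff integral_distr_continuous[OF G T_meas[OF G] \<phi>])
    qed
    moreover have "(\<lambda>n. (\<integral>z. \<phi> (T z) \<partial>(G \<circ> r) n) - (\<integral>x. exp (\<phi> x) - 1 \<partial>(Z \<circ> r) n))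
        \<longlonglongrightarrow> (\<integral>z. \<phi> (T z) \<partial>\<gamma>) - (\<integral>x. exp (\<phi> x) - 1 \<partial>\<rho>)"
      by (intro tendsto_diff weak_star_convergesD[OF conv \<phi>T]
        weak_star_convergesD[OF weak_star_converges_subseq[OF Z(2) r] e])
    ultimately have "(\<integral>z. \<phi> (T z) \<partial>\<gamma>) - (\<integral>x. exp (\<phi> x) - 1 \<partial>\<rho>) \<le> lk"
      using k(3) by (elim LIMSEQ_le) auto
    then show "(\<integral>x. \<phi> x \<partial>distr \<gamma> ?D T) - (\<integral>x. exp (\<phi> x) - 1 \<partial>\<rho>) \<le> lk"
      by (simp add: integral_distr_continuous[OF \<gamma> T_meas[OF \<gamma>] \<phi>])
  qed
  have l1: "KL (distr \<gamma> ?D fst) \<mu> \<le> ennreal l1"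
    by (rule KL_limit[OF _ _ nonneg(1) X(2) nonneg(3) k1 pos(2) lim(2)])
      (auto intro!: continuous_intros)
  have l2: "KL (distr \<gamma> ?D snd) \<nu> \<le> ennreal l2"
    by (rule KL_limit[OF _ _ nonneg(2) Y(2) nonneg(4) k2 pos(3) lim(3)])
      (auto intro!: continuous_intros)
  have l_pos: "0 \<le> lc" "0 \<le> l1" "0 \<le> l2"
    using pos by (auto intro: LIMSEQ_le_const[OF lim(1)] LIMSEQ_le_const[OF lim(2)] LIMSEQ_le_const[OF lim(3)])
  have "lc + l1 + l2 \<le> a"
    using tendsto_add[OF tendsto_add[OF lim(1,2)] lim(3)] sum
    by (intro LIMSEQ_le_const2) auto
  have "HK_squared \<Omega> \<kappa> \<mu> \<nu> \<le> hk_plan_value \<Omega> \<kappa> \<mu> \<nu> \<gamma>"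
    by (rule HK_squared_le[OF \<gamma>])
  also have "\<dots> \<le> ennreal lc + ennreal l1 + ennreal l2"
    unfolding hk_plan_value_def by (intro add_mono lc l1 l2)
  also have "\<dots> = ennreal (lc + l1 + l2)"
    using l_pos by (simp add: ennreal_plus)
  also have "\<dots> \<le> ennreal a"
    by (rule ennreal_leI) fact
  finally show ?thesis .
qed

text \<open>If the inequality failed, a finite bound would fit strictly between the two sides, and a
  subsequence realising the lower limit would stay below it.\<close>

theorem HK_squared_liminf:
  fixes \<Omega> :: "'a::euclidean_space set"
  assumes \<Omega>: "compact \<Omega>" "convex \<Omega>" "\<Omega> \<noteq> {}" and \<kappa>: "0 < \<kappa>"
    and X: "\<And>n. X n \<in> bounded_measures \<Omega> M" "weak_star_converges \<Omega> X \<mu>" "\<mu> \<in> bounded_measures \<Omega> M"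
    and Y: "\<And>n. Y n \<in> bounded_measures \<Omega> M" "weak_star_converges \<Omega> Y \<nu>" "\<nu> \<in> bounded_measures \<Omega> M"
  shows "HK_squared \<Omega> \<kappa> \<mu> \<nu> \<le> liminf (\<lambda>n. HK_squared \<Omega> \<kappa> (X n) (Y n))"
proof (rule ccontr)
  let ?u = "\<lambda>n. HK_squared \<Omega> \<kappa> (X n) (Y n)"
  assume "\<not> ?thesis"
  then obtain b where b: "liminf ?u < b" "b < HK_squared \<Omega> \<kappa> \<mu> \<nu>"
    using dense[of "liminf ?u" "HK_squared \<Omega> \<kappa> \<mu> \<nu>"] by (auto simp: not_le)
  then have "b < top"
    using less_le_trans[OF b(2) top_greatest] by simp
  then obtain a where a: "b = ennreal a"
    by (cases b) auto
  obtain r where r: "strict_mono (r :: nat \<Rightarrow> nat)" "(?u \<circ> r) \<longlonglongrightarrow> liminf ?u"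
    using liminf_subseq_lim[of ?u] by blast
  then obtain N where N: "\<And>n. N \<le> n \<Longrightarrow> ?u (r n) < ennreal a"
    using order_tendstoD(2)[OF r(2) b(1)] by (auto simp: a eventually_sequentially)
  \<comment> \<open>Shifting by \<open>N\<close> makes the bound hold for every index.\<close>
  define s where "s n = r (n + N)" for n
  have s: "strict_mono s"
    using r(1) by (simp add: s_def strict_mono_def)
  have "HK_squared \<Omega> \<kappa> \<mu> \<nu> \<le> ennreal a"
    by (rule HK_squared_limit_le[OF \<Omega> \<kappa> _ weak_star_converges_subseq[OF X(2) s] X(3)
          _ weak_star_converges_subseq[OF Y(2) s] Y(3)])
      (auto simp: s_def intro: X(1) Y(1) N)
  with b(2) show False by (simp add: a)
qed

section \<open>Measurability and existence of the minimizer\<close>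

text \<open>Hat functions on a finite \<delta>-net, divided by their sum. They allow a continuous
  function to be interpolated from finitely many values.\<close>

lemma continuous_partition_of_unity:
  fixes \<Omega> :: "'a::metric_space set"
  assumes compact: "compact \<Omega>" and \<delta>: "0 < \<delta>"
  obtains S and \<phi> :: "'a \<Rightarrow> 'a \<Rightarrow> real" where "finite S" "S \<subseteq> \<Omega>"
    "\<And>s. continuous_on \<Omega> (\<phi> s)" "\<And>s x. 0 \<le> \<phi> s x"
    "\<And>x. x \<in> \<Omega> \<Longrightarrow> (\<Sum>s\<in>S. \<phi> s x) = 1" "\<And>s x. \<phi> s x \<noteq> 0 \<Longrightarrow> dist s x < \<delta>"
proof -
  have "\<Omega> \<subseteq> (\<Union>s\<in>\<Omega>. ball s \<delta>)" using \<delta> by auto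
  then obtain S where S: "S \<subseteq> \<Omega>" "finite S" "\<Omega> \<subseteq> (\<Union>s\<in>S. ball s \<delta>)"
    by (rule compactE_image[OF compact open_ball])
  define w where "w s x = max 0 (\<delta> - dist s x)" for s x :: 'a
  define W where "W x = (\<Sum>s\<in>S. w s x)" for x
  have w: "0 \<le> w s x" for s x by (simp add: w_def)
  have W_nonneg: "0 \<le> W x" for x unfolding W_def by (intro sum_nonneg w)
  have W: "0 < W x" if x: "x \<in> \<Omega>" for x
  proof -
    obtain s where "s \<in> S" "dist s x < \<delta>" using subsetD[OF S(3) x] by auto
    then show ?thesis
      unfolding W_def using S(2) w by (intro sum_pos2[of S s]) (auto simp: w_def)
  qed
  \<comment> \<open>Outside \<Omega> the sum \<open>W\<close> may vanish, but division by 0 gives 0,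
    so sign and support hold everywhere.\<close>
  show ?thesis
  proof (rule that[OF S(2,1), of "\<lambda>s x. w s x / W x"])
    fix s
    have "continuous_on \<Omega> W" "continuous_on \<Omega> (w s)"
      unfolding W_def w_def by (intro continuous_intros)+
    then show "continuous_on \<Omega> (\<lambda>x. w s x / W x)"
      using W by (intro continuous_on_divide) (auto simp: less_imp_neq[THEN not_sym])
  next
    show "0 \<le> w s x / W x" for s x using w W_nonneg by simp
  next
    fix x assume "x \<in> \<Omega>"
    then have "W x \<noteq> 0" using W by (simp add: less_imp_neq[THEN not_sym])
    then show "(\<Sum>s\<in>S. w s x / W x) = 1"
      unfolding sum_divide_distrib[symmetric] by (simp add: W_def)
  next
    show "dist s x < \<delta>" if "w s x / W x \<noteq> 0" for s x
      using that by (auto simp: w_def max_def split: if_splits)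
  qed
qed

section \<open>Weak* neighbourhoods and Borel sets of measures\<close>

lemma integral_uniform_approx:
  fixes f g :: "'a::topological_space \<Rightarrow> real"
  assumes compact: "compact \<Omega>" and \<mu>: "\<mu> \<in> bounded_measures \<Omega> M"
    and f: "continuous_on \<Omega> f" and g: "continuous_on \<Omega> g"
    and le: "\<And>x. x \<in> \<Omega> \<Longrightarrow> \<bar>f x - g x\<bar> \<le> e" and e: "0 \<le> e"
  shows "\<bar>(\<integral>x. f x \<partial>\<mu>) - (\<integral>x. g x \<partial>\<mu>)\<bar> \<le> e * M"
proof -
  have \<mu>': "\<mu> \<in> nonneg_measures \<Omega>" and M: "measure \<mu> \<Omega> \<le> M"
    using \<mu> by (auto simp: bounded_measures_def)
  note int = continuous_on_integrable[OF \<mu>' compact f] continuous_on_integrable[OF \<mu>' compact g]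
  have const: "integrable \<mu> (\<lambda>_. e)"
    by (rule continuous_on_integrable[OF \<mu>' compact continuous_on_const])
  have "\<bar>(\<integral>x. f x \<partial>\<mu>) - (\<integral>x. g x \<partial>\<mu>)\<bar> = \<bar>\<integral>x. f x - g x \<partial>\<mu>\<bar>"
    using int by simp
  also have "\<dots> \<le> (\<integral>x. \<bar>f x - g x\<bar> \<partial>\<mu>)"
    by (rule integral_abs_bound)
  also have "\<dots> \<le> (\<integral>x. e \<partial>\<mu>)"
    using int const le by (intro integral_mono) (auto simp: nonneg_measures_space[OF \<mu>'])
  also have "\<dots> = e * measure \<mu> \<Omega>"
    by (simp add: nonneg_measures_space[OF \<mu>'] mult.commute)
  also have "\<dots> \<le> e * M"
    using M e by (rule mult_left_mono)
  finally show ?thesis .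
qed

lemma openin_weak_star_neighbourhood:
  fixes \<phi> :: "'i \<Rightarrow> 'a::topological_space \<Rightarrow> real"
  assumes "finite S" "\<And>s. s \<in> S \<Longrightarrow> continuous_on \<Omega> (\<phi> s)"
  shows "openin (subtopology (weak_star_topology \<Omega>) (bounded_measures \<Omega> M))
    {\<mu> \<in> bounded_measures \<Omega> M. \<forall>s\<in>S. \<bar>(\<integral>x. \<phi> s x \<partial>\<mu>) - c s\<bar> < e}"
proof -
  let ?U = "\<lambda>s. {\<mu> \<in> nonneg_measures \<Omega>. (\<integral>x. \<phi> s x \<partial>\<mu>) \<in> {y. \<bar>y - c s\<bar> < e}}"
  have "openin (weak_star_topology \<Omega>) (?U s)" if "s \<in> S" for s
  proof -
    have "open {y. \<bar>y - c s\<bar> < e}"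
      by (intro open_Collect_less continuous_intros)
    then show ?thesis
      unfolding weak_star_topology_def openin_topology_generated_by_iff
      using assms(2)[OF that] by (intro generate_topology_on.Basis) blast
  qed
  \<comment> \<open>Intersecting with the whole space covers \<open>S = {}\<close>.\<close>
  then have "openin (weak_star_topology \<Omega>) ((\<Inter>s\<in>S. ?U s) \<inter> nonneg_measures \<Omega>)"
    using openin_INT[OF assms(1), of "weak_star_topology \<Omega>" ?U] by simp
  then have "openin (subtopology (weak_star_topology \<Omega>) (bounded_measures \<Omega> M))
      (((\<Inter>s\<in>S. ?U s) \<inter> nonneg_measures \<Omega>) \<inter> bounded_measures \<Omega> M)"
    by (rule openin_subtopology_Int)
  moreover have "((\<Inter>s\<in>S. ?U s) \<inter> nonneg_measures \<Omega>) \<inter> bounded_measures \<Omega> M =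
      {\<mu> \<in> bounded_measures \<Omega> M. \<forall>s\<in>S. \<bar>(\<integral>x. \<phi> s x \<partial>\<mu>) - c s\<bar> < e}"
    by (auto simp: bounded_measures_def)
  ultimately show ?thesis by simp
qed

text \<open>Finitely many test functions per scale suffice to control weak* convergence, which exhibits a
  sequentially closed set as a countable intersection of open ones.\<close>

theorem sequentially_closed_borel:
  fixes \<Omega> :: "'a::metric_space set"
  assumes compact: "compact \<Omega>" and F: "F \<subseteq> bounded_measures \<Omega> M"
    and closed: "\<And>X \<mu>. (\<And>n :: nat. X n \<in> F) \<Longrightarrow> weak_star_converges \<Omega> X \<mu> \<Longrightarrow>
      \<mu> \<in> bounded_measures \<Omega> M \<Longrightarrow> \<mu> \<in> F"
  shows "F \<in> sets (borel_algebra_of (subtopology (weak_star_topology \<Omega>) (bounded_measures \<Omega> M)))"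
proof -
  let ?C = "bounded_measures \<Omega> M"
  let ?T = "subtopology (weak_star_topology \<Omega>) ?C"
  define Q where "Q m S \<phi> \<longleftrightarrow> finite S \<and> S \<subseteq> \<Omega> \<and> (\<forall>s. continuous_on \<Omega> (\<phi> s)) \<and> (\<forall>s x. 0 \<le> \<phi> s x) \<and>
      (\<forall>x\<in>\<Omega>. (\<Sum>s\<in>S. \<phi> s x) = (1 :: real)) \<and> (\<forall>s x. \<phi> s x \<noteq> 0 \<longrightarrow> dist s x < 1 / real (Suc m))"
    for m S \<phi>
  have "\<exists>S \<phi>. Q m S \<phi>" for m
  proof -
    have pos: "0 < 1 / real (Suc m)" by simp
    show ?thesis
      using continuous_partition_of_unity[OF compact pos] unfolding Q_def by metis
  qed
  then obtain S :: "nat \<Rightarrow> 'a set" and \<phi> :: "nat \<Rightarrow> 'a \<Rightarrow> 'a \<Rightarrow> real" where Q: "\<And>m. Q m (S m) (\<phi> m)"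
    by metis
  have S: "finite (S m)" "S m \<subseteq> \<Omega>" and \<phi>: "continuous_on \<Omega> (\<phi> m s)" "0 \<le> \<phi> m s x"
    and sum_1: "x \<in> \<Omega> \<Longrightarrow> (\<Sum>s\<in>S m. \<phi> m s x) = 1"
    and supp: "\<phi> m s x \<noteq> 0 \<Longrightarrow> dist s x < 1 / real (Suc m)" for m s x
    using Q[of m] unfolding Q_def by blast+
  \<comment> \<open>The errors of all test functions of scale \<open>m\<close> add up to at most
    \<open>1 / real (Suc m)\<close>; \<open>Suc\<close> guards against an empty net.\<close>
  define \<epsilon> where "\<epsilon> m = 1 / (real (Suc m) * real (Suc (card (S m))))" for m
  have \<epsilon>: "0 < \<epsilon> m" "real (card (S m)) * \<epsilon> m \<le> 1 / real (Suc m)" for m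
  proof -
    show "0 < \<epsilon> m"
      unfolding \<epsilon>_def by (intro divide_pos_pos mult_pos_pos) auto
    have "real (card (S m)) / real (Suc (card (S m))) * (1 / real (Suc m)) \<le> 1 * (1 / real (Suc m))"
      by (intro mult_right_mono) auto
    then show "real (card (S m)) * \<epsilon> m \<le> 1 / real (Suc m)"
      by (simp add: \<epsilon>_def mult.commute)
  qed
  define N where "N m \<mu>' = {\<mu> \<in> ?C. \<forall>s\<in>S m. \<bar>(\<integral>x. \<phi> m s x \<partial>\<mu>) - (\<integral>x. \<phi> m s x \<partial>\<mu>')\<bar> < \<epsilon> m}" for m \<mu>'
  define G where "G m = (\<Union>\<mu>'\<in>F. N m \<mu>')" for m
  have "openin ?T (N m \<mu>')" for m \<mu>'
    unfolding N_def by (intro openin_weak_star_neighbourhood S \<phi>)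
  then have "openin ?T (G m)" for m
    unfolding G_def by (intro openin_Union) auto
  then have G_sets: "G m \<in> sets (borel_algebra_of ?T)" for m
    unfolding borel_algebra_of_def using openin_subset[of ?T] by (subst sets_measure_of) auto
  have "F = (\<Inter>m. G m)"
  proof (intro equalityI subsetI)
    fix \<mu> assume "\<mu> \<in> F"
    then have "\<mu> \<in> N m \<mu>" for m
      using F \<epsilon>(1) by (auto simp: N_def)
    then show "\<mu> \<in> (\<Inter>m. G m)"
      using \<open>\<mu> \<in> F\<close> by (auto simp: G_def)
  next
    fix \<mu> assume "\<mu> \<in> (\<Inter>m. G m)"
    \<comment> \<open>One element of \<open>F\<close> close to \<mu> is chosen at each scale; their
      convergence to \<mu> puts \<mu> into \<open>F\<close>.\<close>
    then have "\<forall>m. \<exists>\<mu>'. \<mu>' \<in> F \<and> \<mu> \<in> N m \<mu>'"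
      by (auto simp: G_def)
    then obtain X where X: "\<And>m. X m \<in> F" "\<And>m. \<mu> \<in> N m (X m)"
      by metis
    have X_C: "X m \<in> ?C" for m using X(1) F by blast
    have \<mu>_C: "\<mu> \<in> ?C" using X(2)[of 0] by (simp add: N_def)
    have near: "\<bar>(\<integral>x. \<phi> m s x \<partial>X m) - (\<integral>x. \<phi> m s x \<partial>\<mu>)\<bar> \<le> \<epsilon> m" if "s \<in> S m" for m s
      using X(2)[of m] that by (force simp: N_def abs_minus_commute)
    have M: "0 \<le> M"
      using \<mu>_C unfolding bounded_measures_def by (auto intro: order_trans[OF measure_nonneg])
    have "weak_star_converges \<Omega> X \<mu>"
      unfolding weak_star_converges_def
    proof (intro allI impI LIMSEQ_I)
      fix f :: "'a \<Rightarrow> real" and e :: real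
      assume f: "continuous_on \<Omega> f" and e: "0 < e"
      obtain B where B: "0 < B" "\<And>x. x \<in> \<Omega> \<Longrightarrow> \<bar>f x\<bar> \<le> B"
        using continuous_on_compact_bounded[OF compact f] by blast
      \<comment> \<open>Interpolating \<open>f\<close> costs \<open>e' * M\<close> in each of two
        integrals, together less than \<open>e\<close>; the rest is left for the finite sum. The
        summand 1 covers \<open>M = 0\<close>.\<close>
      define e' where "e' = e / (4 * (M + 1))"
      have e': "0 < e'" "2 * (e' * M) < e"
        using e M by (auto simp: e'_def field_simps intro: add_pos_nonneg)
      obtain d where d: "0 < d" "\<And>x y. x \<in> \<Omega> \<Longrightarrow> y \<in> \<Omega> \<Longrightarrow> dist y x < d \<Longrightarrow> dist (f y) (f x) < e'"
        using compact_uniformly_continuous[OF f compact] e'(1)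
        unfolding uniformly_continuous_on_def by blast
      obtain m1 where m1: "1 / real (Suc m1) < d"
        using nat_approx_posE[OF d(1)] by (auto simp: inverse_eq_divide)
      have "0 < (e - 2 * (e' * M)) / B" using e' B(1) by simp
      then obtain m2 where m2: "1 / real (Suc m2) < (e - 2 * (e' * M)) / B"
        by (rule nat_approx_posE) (auto simp: inverse_eq_divide)
      show "\<exists>m0. \<forall>m\<ge>m0. norm ((\<integral>x. f x \<partial>X m) - (\<integral>x. f x \<partial>\<mu>)) < e"
      proof (intro exI allI impI)
        fix m assume m: "max m1 m2 \<le> m"
        have "1 / real (Suc m) \<le> 1 / real (Suc m1)" "1 / real (Suc m) \<le> 1 / real (Suc m2)"
          using m by (auto intro!: divide_left_mono)
        then have m_d: "1 / real (Suc m) < d" and m_B: "1 / real (Suc m) < (e - 2 * (e' * M)) / B"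
          using m1 m2 by linarith+
        \<comment> \<open>Interpolation of \<open>f\<close> from its values on the net; uniform
          continuity makes it accurate once the mesh is below \<open>d\<close>.\<close>
        define g where "g x = (\<Sum>s\<in>S m. f s * \<phi> m s x)" for x
        have g: "continuous_on \<Omega> g"
          unfolding g_def by (intro continuous_intros \<phi>)
        have fg: "\<bar>f x - g x\<bar> \<le> e'" if x: "x \<in> \<Omega>" for x
        proof -
          have "f x - g x = (\<Sum>s\<in>S m. (f x - f s) * \<phi> m s x)"
            using sum_1[OF x, of m] by (simp add: g_def left_diff_distrib sum_subtractf flip: sum_distrib_left)
          also have "\<bar>\<dots>\<bar> \<le> (\<Sum>s\<in>S m. \<bar>(f x - f s) * \<phi> m s x\<bar>)"
            by (rule sum_abs)
          also have "\<dots> \<le> (\<Sum>s\<in>S m. e' * \<phi> m s x)"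
          proof (rule sum_mono)
            fix s assume s: "s \<in> S m"
            show "\<bar>(f x - f s) * \<phi> m s x\<bar> \<le> e' * \<phi> m s x"
            proof (cases "\<phi> m s x = 0")
              case False
              then have "dist s x < d" using supp[OF False] m_d by simp
              then have "\<bar>f x - f s\<bar> \<le> e'"
                using d(2)[OF x, of s] S(2)[of m] s by (auto simp: dist_real_def)
              then show ?thesis
                using \<phi>(2)[of m s x] by (simp add: abs_mult mult_right_mono)
            qed simp
          qed
          also have "\<dots> = e'"
            using sum_1[OF x, of m] by (simp flip: sum_distrib_left)
          finally show ?thesis .
        qed
        have g_int: "(\<integral>x. g x \<partial>\<rho>) = (\<Sum>s\<in>S m. f s * (\<integral>x. \<phi> m s x \<partial>\<rho>))" if "\<rho> \<in> ?C" for \<rho>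
        proof -
          have \<rho>: "\<rho> \<in> nonneg_measures \<Omega>" using that by (simp add: bounded_measures_def)
          show ?thesis
            unfolding g_def using continuous_on_integrable[OF \<rho> compact \<phi>(1)]
            by (subst Bochner_Integration.integral_sum) auto
        qed
        have "(\<integral>x. g x \<partial>X m) - (\<integral>x. g x \<partial>\<mu>) =
            (\<Sum>s\<in>S m. f s * ((\<integral>x. \<phi> m s x \<partial>X m) - (\<integral>x. \<phi> m s x \<partial>\<mu>)))"
          by (simp add: g_int[OF X_C] g_int[OF \<mu>_C] sum_subtractf right_diff_distrib)
        also have "\<bar>\<dots>\<bar> \<le> (\<Sum>s\<in>S m. \<bar>f s * ((\<integral>x. \<phi> m s x \<partial>X m) - (\<integral>x. \<phi> m s x \<partial>\<mu>))\<bar>)"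
          by (rule sum_abs)
        also have "\<dots> \<le> (\<Sum>s\<in>S m. B * \<epsilon> m)"
          using B S(2)[of m] near unfolding abs_mult by (intro sum_mono mult_mono) auto
        also have "\<dots> = B * (real (card (S m)) * \<epsilon> m)" by simp
        also have "\<dots> \<le> B * (1 / real (Suc m))"
          using B(1) \<epsilon>(2) by (intro mult_left_mono) auto
        also have "\<dots> < e - 2 * (e' * M)"
          using m_B B(1) by (simp add: pos_less_divide_eq mult.commute)
        finally have "\<bar>(\<integral>x. g x \<partial>X m) - (\<integral>x. g x \<partial>\<mu>)\<bar> < e - 2 * (e' * M)" .
        moreover have "\<bar>(\<integral>x. f x \<partial>X m) - (\<integral>x. g x \<partial>X m)\<bar> \<le> e' * M"
          "\<bar>(\<integral>x. f x \<partial>\<mu>) - (\<integral>x. g x \<partial>\<mu>)\<bar> \<le> e' * M"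
          using e'(1) by (intro integral_uniform_approx[OF compact] X_C \<mu>_C f g fg; simp)+
        ultimately show "norm ((\<integral>x. f x \<partial>X m) - (\<integral>x. f x \<partial>\<mu>)) < e"
          unfolding real_norm_def by linarith
      qed
    qed
    then show "\<mu> \<in> F"
      by (rule closed[OF X(1) _ \<mu>_C])
  qed
  also have "(\<Inter>m. G m) \<in> sets (borel_algebra_of ?T)"
    using G_sets by (intro sets.countable_INT) auto
  finally show ?thesis .
qed

lemma space_borel_probability:
  assumes "\<Lambda> \<in> borel_probabilities (subtopology (weak_star_topology \<Omega>) (bounded_measures \<Omega> M))"
  shows "space \<Lambda> = bounded_measures \<Omega> M"
proof -
  have "space \<Lambda> = space (borel_algebra_of (subtopology (weak_star_topology \<Omega>) (bounded_measures \<Omega> M)))"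
    using assms by (intro sets_eq_imp_space_eq) (simp add: borel_probabilities_def)
  also have "\<dots> = nonneg_measures \<Omega> \<inter> bounded_measures \<Omega> M"
    by (simp add: borel_algebra_of_def space_measure_of_conv)
  also have "\<dots> = bounded_measures \<Omega> M"
    by (auto simp: bounded_measures_def)
  finally show ?thesis .
qed

lemma weak_star_converges_const: "weak_star_converges \<Omega> (\<lambda>_. \<mu>) \<mu>"
  by (simp add: weak_star_converges_def)

text \<open>Semicontinuity, with the second argument held constant, makes the sublevel sets
  sequentially closed and hence Borel.\<close>

lemma borel_measurable_HK_squared:
  fixes \<Omega> :: "'a::euclidean_space set"
  assumes \<Omega>: "compact \<Omega>" "convex \<Omega>" "\<Omega> \<noteq> {}" and \<kappa>: "0 < \<kappa>"
    and \<Lambda>: "\<Lambda> \<in> borel_probabilities (subtopology (weak_star_topology \<Omega>) (bounded_measures \<Omega> M))"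
    and \<nu>: "\<nu> \<in> bounded_measures \<Omega> M"
  shows "(\<lambda>\<mu>. HK_squared \<Omega> \<kappa> \<mu> \<nu>) \<in> borel_measurable \<Lambda>"
proof (rule borel_measurableI_le)
  fix b :: ennreal
  let ?F = "{\<mu> \<in> bounded_measures \<Omega> M. HK_squared \<Omega> \<kappa> \<mu> \<nu> \<le> b}"
  have "?F \<in> sets (borel_algebra_of (subtopology (weak_star_topology \<Omega>) (bounded_measures \<Omega> M)))"
  proof (rule sequentially_closed_borel[OF \<Omega>(1)])
    fix X \<mu> assume X: "\<And>n :: nat. X n \<in> ?F" "weak_star_converges \<Omega> X \<mu>" "\<mu> \<in> bounded_measures \<Omega> M"
    have "HK_squared \<Omega> \<kappa> \<mu> \<nu> \<le> liminf (\<lambda>n. HK_squared \<Omega> \<kappa> (X n) \<nu>)"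
      using X(1) by (intro HK_squared_liminf[OF \<Omega> \<kappa> _ X(2,3) \<nu> weak_star_converges_const \<nu>]) auto
    also have "\<dots> \<le> limsup (\<lambda>n. HK_squared \<Omega> \<kappa> (X n) \<nu>)"
      by (rule Liminf_le_Limsup) simp
    also have "\<dots> \<le> b"
      using X(1) by (intro Limsup_bounded) auto
    finally show "\<mu> \<in> ?F" using X(3) by simp
  qed auto
  then show "{\<mu> \<in> space \<Lambda>. HK_squared \<Omega> \<kappa> \<mu> \<nu> \<le> b} \<in> sets \<Lambda>"
    using \<Lambda> by (simp add: space_borel_probability[OF \<Lambda>] borel_probabilities_def)
qed

theorem proposition3p1:
  fixes \<Omega> :: "'a::euclidean_space set" and M \<kappa> :: real and \<Lambda> :: "'a measure measure"
  assumes "compact \<Omega>" and "convex \<Omega>" and "interior \<Omega> \<noteq> {}"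
    and "0 < M" and "0 < \<kappa>"
    and "\<Lambda> \<in> borel_probabilities
           (subtopology (weak_star_topology \<Omega>) (bounded_measures \<Omega> M))"
  shows "\<exists>\<nu> \<in> bounded_measures \<Omega> M. \<forall>\<nu>' \<in> nonneg_measures \<Omega>.
           HK_barycenter_functional \<Omega> \<Lambda> \<kappa> \<nu> \<le> HK_barycenter_functional \<Omega> \<Lambda> \<kappa> \<nu>'"
proof -
  let ?C = "bounded_measures \<Omega> M"
  let ?J = "HK_barycenter_functional \<Omega> \<Lambda> \<kappa>"
  have \<Omega>: "compact \<Omega>" "convex \<Omega>" "\<Omega> \<noteq> {}"
    using assms(1-3) by auto
  have space: "space \<Lambda> = ?C"
    by (rule space_borel_probability[OF assms(6)])
  \<comment> \<open>The null measure shows that there are admissible measures, so a minimising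
    sequence exists.\<close>
  have "finite_measure (null_measure (restrict_space borel \<Omega>))"
    by (rule finite_measureI) simp
  then have "null_measure (restrict_space borel \<Omega>) \<in> ?C"
    using \<open>0 < M\<close> by (simp add: bounded_measures_def nonneg_measures_def measure_def)
  then obtain J :: "nat \<Rightarrow> ennreal" where J: "decseq J" "range J \<subseteq> ?J ` ?C" "Inf (?J ` ?C) = (INF n. J n)"
    using ennreal_Inf_countable_INF[of "?J ` ?C"] by blast
  then have "\<forall>n. \<exists>\<nu>. \<nu> \<in> ?C \<and> ?J \<nu> = J n"
    by (metis imageE rangeI subsetD)
  then obtain Y where Y: "\<And>n. Y n \<in> ?C" "\<And>n. ?J (Y n) = J n"
    by metis
  obtain r \<nu> where r: "strict_mono r" and \<nu>: "\<nu> \<in> ?C" and conv: "weak_star_converges \<Omega> (Y \<circ> r) \<nu>"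
    using bounded_measures_sequentially_compact[OF \<Omega>, of Y M] Y(1) by blast
  have lsc: "HK_squared \<Omega> \<kappa> \<mu> \<nu> \<le> liminf (\<lambda>n. HK_squared \<Omega> \<kappa> \<mu> (Y (r n)))" if \<mu>: "\<mu> \<in> ?C" for \<mu>
    using HK_squared_liminf[OF \<Omega> \<open>0 < \<kappa>\<close> \<mu> weak_star_converges_const \<mu>, of "Y \<circ> r"] Y(1) conv \<nu>
    by simp
  have "?J \<nu> \<le> (\<integral>\<^sup>+\<mu>. liminf (\<lambda>n. HK_squared \<Omega> \<kappa> \<mu> (Y (r n))) \<partial>\<Lambda>)"
    unfolding HK_barycenter_functional_def by (intro nn_integral_mono lsc) (simp add: space)
  also have "\<dots> \<le> liminf (\<lambda>n. \<integral>\<^sup>+\<mu>. HK_squared \<Omega> \<kappa> \<mu> (Y (r n)) \<partial>\<Lambda>)"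
    by (intro nn_integral_liminf borel_measurable_HK_squared[OF \<Omega> \<open>0 < \<kappa>\<close> assms(6)] Y(1))
  also have "\<dots> = liminf (\<lambda>n. J (r n))"
    by (simp add: Y(2) flip: HK_barycenter_functional_def)
  \<comment> \<open>The values \<open>J\<close> decrease to their infimum, and so does every
    subsequence.\<close>
  also have "\<dots> = (INF n. J n)"
    using LIMSEQ_subseq_LIMSEQ[OF LIMSEQ_INF[OF J(1)] r]
    by (intro lim_imp_Liminf) (auto simp: o_def)
  finally have min: "?J \<nu> \<le> ?J \<nu>'" if "\<nu>' \<in> ?C" for \<nu>'
    using that J(3) by (metis INF_lower order_trans)
  show ?thesis
  proof (intro bexI[OF _ \<nu>] ballI)
    fix \<nu>' assume \<nu>': "\<nu>' \<in> nonneg_measures \<Omega>"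
    show "?J \<nu> \<le> ?J \<nu>'"
    proof (cases "measure \<nu>' \<Omega> \<le> M")
      case True
      then show ?thesis
        using \<nu>' by (intro min) (simp add: bounded_measures_def)
    next
      case False
      let ?r = "M / measure \<nu>' \<Omega>"
      let ?\<rho> = "density \<nu>' (\<lambda>_. ennreal ?r)"
      have r: "0 \<le> ?r" "?r * measure \<nu>' \<Omega> = M"
        using False \<open>0 < M\<close> by auto
      have "?\<rho> \<in> ?C"
        using scaled_in_nonneg_measures[OF \<nu>' r(1)] measure_scaled[OF \<nu>' r(1)] r(2)
        by (simp add: bounded_measures_def)
      then have "?J \<nu> \<le> ?J ?\<rho>" by (rule min)
      also have "\<dots> \<le> ?J \<nu>'"
        unfolding HK_barycenter_functional_def using False \<nu>'
        by (intro nn_integral_mono HK_squared_shrink[OF \<Omega>(1) \<open>0 < \<kappa>\<close> \<open>0 < M\<close>]) (simp_all add: space)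
      finally show ?thesis .
    qed
  qed
qed

end
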